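(* Let $M$ be a manifold and let $\mathcal H$ be a connection on $M$. Then the formula $$S(v)=\bigl(\pi_*\big|_{\mathcal H_v}\bigr)^{-1}(v),\qquad v\in TM,$$ where $\pi:TM\to M$ is the natural projection, defines a SODE $S$ on $M$.
   Context: $M$ is a smooth, finite-dimensional, Hausdorff, paracompact, connected manifold; all objects are smooth. $TTM$ has two vector bundle structures over $TM$: $\pi_T:TTM\to TM$ (the usual tangent bundle projection) and $\pi_*:TTM\to TM$ (the tangent map of $\pi:TM\to M$). The vertical bundle is $\mathcal V=\ker \pi_*\subset TTM$ (so $\mathcal V_v=\ker(\pi_*:T_vTM\to T_{\pi(v)}M)$). A (general, possibly nonlinear) connection on $M$ is a smooth subbundle $\mathcal H$ of $\pi_T:TTM\to TM$ with $TTM=\mathcal H\oplus\mathcal V$; for $v\in T_pM$, $\pi_*$ restricts to an isomorphism $\mathcal H_v\to T_pM$. A SODE on $M$ is a smooth section $S:TM\to TTM$ of both $\pi_T$ and $\pi_*$ (equivalently, a vector field on $TM$ fixed by the canonical involution of $TTM$); locally $S:(x,y)\mapsto(x,y,y,\mathcal S(x,y))$. *)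

theory Defs
  imports "HOL-Analysis.Analysis" "HOL-Library.Function_Algebras"
begin

section \<open>Pointwise real vector space structure on functions\<close>

text \<open>Addition and zero come from \<^theory>\<open>HOL-Library.Function_Algebras\<close>; with scalar
  multiplication the library's \<^const>\<open>subspace\<close>, \<^const>\<open>span\<close> and \<^const>\<open>independent\<close>
  apply to the fibres of the tangent bundle defined below.\<close>

instantiation "fun" :: (type, real_vector) real_vector
begin

definition scaleR_fun_def: "r *\<^sub>R f = (\<lambda>x. r *\<^sub>R f x)"

instance
  by standard (auto simp: scaleR_fun_def fun_eq_iff scaleR_add_right scaleR_add_left)

end

section \<open>Smooth functions between finite-dimensional normed spaces\<close>

text \<open>Meant for open \<open>U\<close> in a finite-dimensional space, where differentiability together with
  continuity of all directional derivatives is continuous differentiability.\<close>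

primrec Ck_on :: "nat \<Rightarrow> 'e::real_normed_vector set \<Rightarrow> ('e \<Rightarrow> 'f::real_normed_vector) \<Rightarrow> bool" where
  "Ck_on 0 U f \<longleftrightarrow> continuous_on U f"
| "Ck_on (Suc k) U f \<longleftrightarrow> (\<forall>x\<in>U. f differentiable (at x)) \<and>
     (\<forall>v. Ck_on k U (\<lambda>x. frechet_derivative f (at x) v))"

definition smooth_on :: "'e::real_normed_vector set \<Rightarrow> ('e \<Rightarrow> 'f::real_normed_vector) \<Rightarrow> bool" where
  "smooth_on U f \<longleftrightarrow> (\<forall>k. Ck_on k U f)"

section \<open>Manifolds\<close>

text \<open>A chart is a domain together with a coordinate map, whose values outside the domain are
  irrelevant. A manifold is given by an atlas, not necessarily maximal, modelled on the
  vector space \<open>'e\<close>; points and topology are read off from the atlas.\<close>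

type_synonym ('a, 'e) chart = "'a set \<times> ('a \<Rightarrow> 'e)"

definition carrier_of :: "('a, 'e) chart set \<Rightarrow> 'a set" where
  "carrier_of A = (\<Union>c\<in>A. fst c)"

definition chart_inv :: "('a, 'e) chart \<Rightarrow> 'e \<Rightarrow> 'a" where
  "chart_inv c = inv_into (fst c) (snd c)"

definition transition :: "('a, 'e) chart \<Rightarrow> ('a, 'e) chart \<Rightarrow> 'e \<Rightarrow> 'e" where
  "transition c d = snd d \<circ> chart_inv c"

definition smooth_atlas :: "('a, 'e::real_normed_vector) chart set \<Rightarrow> bool" where
  "smooth_atlas A \<longleftrightarrow>
     (\<forall>c\<in>A. inj_on (snd c) (fst c) \<and> open (snd c ` fst c)) \<and>
     (\<forall>c\<in>A. \<forall>d\<in>A. open (snd c ` (fst c \<inter> fst d)) \<and>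
        smooth_on (snd c ` (fst c \<inter> fst d)) (transition c d))"

definition atlas_topology :: "('a, 'e::real_normed_vector) chart set \<Rightarrow> 'a topology" where
  "atlas_topology A =
     topology (\<lambda>W. W \<subseteq> carrier_of A \<and> (\<forall>c\<in>A. open (snd c ` (W \<inter> fst c))))"

lemma openin_atlas_topology:
  assumes "smooth_atlas A"
  shows "openin (atlas_topology A) W \<longleftrightarrow>
    W \<subseteq> carrier_of A \<and> (\<forall>c\<in>A. open (snd c ` (W \<inter> fst c)))"
proof -
  have inj: "inj_on (snd c) (fst c)" if "c \<in> A" for c
    using assms that by (auto simp: smooth_atlas_def)
  have "istopology (\<lambda>W. W \<subseteq> carrier_of A \<and> (\<forall>c\<in>A. open (snd c ` (W \<inter> fst c))))"
    unfolding istopology_def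
  proof (intro conjI allI impI ballI)
    fix S T c
    assume S: "S \<subseteq> carrier_of A \<and> (\<forall>c\<in>A. open (snd c ` (S \<inter> fst c)))"
      and T: "T \<subseteq> carrier_of A \<and> (\<forall>c\<in>A. open (snd c ` (T \<inter> fst c)))"
    show "S \<inter> T \<subseteq> carrier_of A" using S by auto
    assume c: "c \<in> A"
    have "snd c ` (S \<inter> T \<inter> fst c) = snd c ` (S \<inter> fst c) \<inter> snd c ` (T \<inter> fst c)"
      using inj_on_image_Int[OF inj[OF c], of "S \<inter> fst c" "T \<inter> fst c"]
      by (simp add: Int_ac)
    then show "open (snd c ` (S \<inter> T \<inter> fst c))" using S T c by auto
  next
    fix \<K> assume K: "\<forall>W\<in>\<K>. W \<subseteq> carrier_of A \<and> (\<forall>c\<in>A. open (snd c ` (W \<inter> fst c)))"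
    show "\<Union>\<K> \<subseteq> carrier_of A" using K by auto
    fix c assume c: "c \<in> A"
    have "snd c ` (\<Union>\<K> \<inter> fst c) = (\<Union>W\<in>\<K>. snd c ` (W \<inter> fst c))" by auto
    then show "open (snd c ` (\<Union>\<K> \<inter> fst c))" using K c by auto
  qed
  then show ?thesis by (simp add: atlas_topology_def)
qed

definition paracompact_space :: "'a topology \<Rightarrow> bool" where
  "paracompact_space X \<longleftrightarrow>
     (\<forall>\<U>. (\<forall>U\<in>\<U>. openin X U) \<and> \<Union>\<U> = topspace X \<longrightarrow>
        (\<exists>\<V>. (\<forall>V\<in>\<V>. openin X V) \<and> \<Union>\<V> = topspace X \<and>
             (\<forall>V\<in>\<V>. \<exists>U\<in>\<U>. V \<subseteq> U) \<and> locally_finite_in X \<V>))"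

text \<open>The model space is not taken in \<^class>\<open>euclidean_space\<close>, because that class excludes
  dimension 0.\<close>

definition smooth_manifold :: "('a, 'e::real_normed_vector) chart set \<Rightarrow> bool" where
  "smooth_manifold A \<longleftrightarrow>
     (\<exists>B::'e set. finite B \<and> span B = UNIV) \<and>
     smooth_atlas A \<and>
     Hausdorff_space (atlas_topology A) \<and>
     paracompact_space (atlas_topology A) \<and>
     connected_space (atlas_topology A)"

definition smooth_map_on :: "'a set \<Rightarrow> ('a, 'e::real_normed_vector) chart set \<Rightarrow>
    ('b, 'f::real_normed_vector) chart set \<Rightarrow> ('a \<Rightarrow> 'b) \<Rightarrow> bool" where
  "smooth_map_on W A B f \<longleftrightarrow>
     continuous_map (subtopology (atlas_topology A) W) (atlas_topology B) f \<and>
     (\<forall>c\<in>A. \<forall>d\<in>B. smooth_on (snd c ` (W \<inter> fst c \<inter> f -` fst d)) (snd d \<circ> f \<circ> chart_inv c))"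

section \<open>Tangent bundles\<close>

text \<open>A tangent vector at \<open>p\<close> is a pair of \<open>p\<close> and the family of its coordinate vectors in all
  charts of the atlas around \<open>p\<close>, related by the derivatives of the transition maps. The
  family is 0 at all other arguments, so that equality of tangent vectors is equality of
  pairs.\<close>

type_synonym ('a, 'e) tvec = "'a \<times> (('a, 'e) chart \<Rightarrow> 'e)"

definition tangent_bundle :: "('a, 'e::real_normed_vector) chart set \<Rightarrow> ('a, 'e) tvec set" where
  "tangent_bundle A = {(p, \<xi>). p \<in> carrier_of A \<and>
     (\<forall>c\<in>A. \<forall>d\<in>A. p \<in> fst c \<inter> fst d \<longrightarrow>
        \<xi> d = frechet_derivative (transition c d) (at (snd c p)) (\<xi> c)) \<and>
     (\<forall>c. \<not> (c \<in> A \<and> p \<in> fst c) \<longrightarrow> \<xi> c = 0)}"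

definition tangent_chart :: "('a, 'e::real_normed_vector) chart set \<Rightarrow> ('a, 'e) chart \<Rightarrow>
    (('a, 'e) tvec, 'e \<times> 'e) chart" where
  "tangent_chart A c =
     ({v \<in> tangent_bundle A. fst v \<in> fst c}, \<lambda>v. (snd c (fst v), snd v c))"

text \<open>This atlas makes the tangent bundle of \<open>A\<close> a manifold, so the construction can be iterated:
  with \<open>TA = tangent_atlas A\<close>, the set \<open>tangent_bundle TA\<close> is the double tangent bundle. Its
  two projections to \<open>tangent_bundle A\<close> are \<^const>\<open>fst\<close> and \<open>tangent_map TA A fst\<close>.\<close>

definition tangent_atlas :: "('a, 'e::real_normed_vector) chart set \<Rightarrow>
    (('a, 'e) tvec, 'e \<times> 'e) chart set" where
  "tangent_atlas A = tangent_chart A ` A"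

definition chart_at :: "('a, 'e) chart set \<Rightarrow> 'a \<Rightarrow> ('a, 'e) chart" where
  "chart_at A p = (SOME c. c \<in> A \<and> p \<in> fst c)"

text \<open>For \<open>f\<close> smooth near \<open>p\<close> the result does not depend on the chart picked around \<open>p\<close>, by the
  chain rule.\<close>

definition tangent_map :: "('a, 'e::real_normed_vector) chart set \<Rightarrow>
    ('b, 'f::real_normed_vector) chart set \<Rightarrow> ('a \<Rightarrow> 'b) \<Rightarrow> ('a, 'e) tvec \<Rightarrow> ('b, 'f) tvec" where
  "tangent_map A B f v =
     (let p = fst v; c = chart_at A p in
       (f p, \<lambda>d. if d \<in> B \<and> f p \<in> fst d
                 then frechet_derivative (snd d \<circ> f \<circ> chart_inv c) (at (snd c p)) (snd v c)
                 else 0))"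

definition fibre :: "('a, 'e) tvec set \<Rightarrow> 'a \<Rightarrow> (('a, 'e) chart \<Rightarrow> 'e) set" where
  "fibre E p = {\<xi>. (p, \<xi>) \<in> E}"

section \<open>Connections and SODEs\<close>

text \<open>Smooth subbundles of the tangent bundle of \<open>A\<close> over \<open>A\<close>: subsets of the total space that
  locally have a smooth frame \<open>\<sigma> 0, \<dots>, \<sigma> (k - 1)\<close>.\<close>

definition smooth_subbundle :: "('a, 'e::real_normed_vector) chart set \<Rightarrow>
    ('a, 'e) tvec set \<Rightarrow> bool" where
  "smooth_subbundle A H \<longleftrightarrow>
     H \<subseteq> tangent_bundle A \<and>
     (\<forall>p\<in>carrier_of A. \<exists>W k. \<exists>\<sigma> :: nat \<Rightarrow> 'a \<Rightarrow> ('a, 'e) tvec.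
        openin (atlas_topology A) W \<and> p \<in> W \<and>
        (\<forall>i<k. smooth_map_on W A (tangent_atlas A) (\<sigma> i) \<and> (\<forall>q\<in>W. fst (\<sigma> i q) = q)) \<and>
        (\<forall>q\<in>W. inj_on (\<lambda>i. snd (\<sigma> i q)) {..<k} \<and>
                independent ((\<lambda>i. snd (\<sigma> i q)) ` {..<k}) \<and>
                span ((\<lambda>i. snd (\<sigma> i q)) ` {..<k}) = fibre H q))"

abbreviation TM :: "('a, 'e::real_normed_vector) chart set \<Rightarrow> ('a, 'e) tvec set" where
  "TM A \<equiv> tangent_bundle A"

abbreviation TTM :: "('a, 'e::real_normed_vector) chart set \<Rightarrow>
    (('a, 'e) tvec, 'e \<times> 'e) tvec set" where
  "TTM A \<equiv> tangent_bundle (tangent_atlas A)"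

abbreviation pi_star :: "('a, 'e::real_normed_vector) chart set \<Rightarrow>
    (('a, 'e) tvec, 'e \<times> 'e) tvec \<Rightarrow> ('a, 'e) tvec" where
  "pi_star A \<equiv> tangent_map (tangent_atlas A) A fst"

definition vertical_bundle :: "('a, 'e::real_normed_vector) chart set \<Rightarrow>
    (('a, 'e) tvec, 'e \<times> 'e) tvec set" where
  "vertical_bundle A = {w \<in> TTM A. snd (pi_star A w) = 0}"

definition connection :: "('a, 'e::real_normed_vector) chart set \<Rightarrow>
    (('a, 'e) tvec, 'e \<times> 'e) tvec set \<Rightarrow> bool" where
  "connection A H \<longleftrightarrow>
     smooth_subbundle (tangent_atlas A) H \<and>
     (\<forall>v\<in>TM A. fibre H v \<inter> fibre (vertical_bundle A) v = {0} \<and>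
        {h + u | h u. h \<in> fibre H v \<and> u \<in> fibre (vertical_bundle A) v} = fibre (TTM A) v)"

definition SODE :: "('a, 'e::real_normed_vector) chart set \<Rightarrow>
    (('a, 'e) tvec \<Rightarrow> (('a, 'e) tvec, 'e \<times> 'e) tvec) \<Rightarrow> bool" where
  "SODE A S \<longleftrightarrow>
     smooth_map_on (TM A) (tangent_atlas A) (tangent_atlas (tangent_atlas A)) S \<and>
     (\<forall>v\<in>TM A. fst (S v) = v \<and> pi_star A (S v) = v)"

end

theory Submission
  imports Defs
begin

text \<open>In the charts of \<open>TTM\<close>, \<open>\<pi>\<^sub>*\<close> is the projection \<open>(x, y, X, Y) \<mapsto> (x, X)\<close>, hence it is linear on
  the fibres of \<open>TTM\<close> over \<open>TM\<close>, with kernel the vertical spaces, and restricts to an isomorphism on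
  their complements \<open>\<H>\<^sub>v\<close>. Smoothness of \<open>S\<close> is local. In coordinates, a smooth local frame
  \<open>(X\<^sub>i, Y\<^sub>i)\<close> of \<open>\<H>\<close> has pointwise independent first components, so there are functionals \<open>L\<^sub>i\<close>
  depending smoothly on the base point with \<open>L\<^sub>i(X\<^sub>j) = \<delta>\<^sub>i\<^sub>j\<close>, and
  \<open>S(x, y) = (\<Sum>\<^sub>i L\<^sub>i(y) X\<^sub>i, \<Sum>\<^sub>i L\<^sub>i(y) Y\<^sub>i)\<close>.\<close>

section \<open>Finite-dimensional normed spaces\<close>

text \<open>The model space carries an arbitrary norm and is only known to have a finite spanning
  set, so continuity of coordinate functionals has to be established before any calculus. It is
  needed because \<open>Ck_on\<close> controls derivatives in fixed directions, whereas the chain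
  rule and the fibre part of a tangent chart change differentiate in directions that move with the
  point; expanding those directions in coordinates closes the gap. Neither bijectivity nor
  smoothness rests on a dimension count: the rank \<open>k\<close> of a local frame is never
  compared with the dimension of the manifold. The first components X_i are independent because a
  combination whose first component is zero is both horizontal and vertical, hence zero. That y lies
  in their span follows from the frame spanning the horizontal space and from
  \<open>pi_star A (S v) = v\<close>. So a left inverse of the injection taking coefficients a_i to
  the sum of the a_i X_i suffices, and it can be built by elimination rather than by inverting a
  matrix.\<close>

lemma finite_independent_coefficients_bounded:
  fixes B :: "'e::real_normed_vector set"
  assumes "finite B" "independent B"
  shows "\<exists>C>0. \<forall>c. \<forall>b\<in>B. \<bar>c b\<bar> \<le> C * norm (\<Sum>b\<in>B. c b *\<^sub>R b)"
  using assms
proof (induction B rule: finite_induct)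
  case empty
  show ?case by (intro exI[of _ 1]) auto
next
  case (insert a B)
  have ind: "independent B" and a: "a \<notin> span B"
    using insert.prems insert.hyps by (auto simp: independent_insert)
  obtain C where C: "C > 0" "\<And>c b. b \<in> B \<Longrightarrow> \<bar>c b\<bar> \<le> C * norm (\<Sum>b\<in>B. c b *\<^sub>R b)"
    using insert.IH[OF ind] by blast
  \<comment> \<open>\<open>a\<close> has positive distance from \<open>span B\<close>: otherwise
    combinations of \<open>B\<close> converge to \<open>a\<close>, the bound for \<open>B\<close>
    makes their coefficients Cauchy, and the limit combination puts \<open>a\<close> into the
    span.\<close>
  have "\<exists>d>0. \<forall>c. d \<le> norm (a - (\<Sum>b\<in>B. c b *\<^sub>R b))"
  proof (rule ccontr)
    assume neg: "\<not> ?thesis"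
    have "\<exists>c. norm (a - (\<Sum>b\<in>B. c b *\<^sub>R b)) < inverse (real (Suc n))" for n
      using neg[simplified, rule_format, of "inverse (real (Suc n))"] by (simp add: not_le)
    then obtain c where c: "\<And>n. norm (a - (\<Sum>b\<in>B. c n b *\<^sub>R b)) < inverse (real (Suc n))"
      by metis
    define s where "s n = (\<Sum>b\<in>B. c n b *\<^sub>R b)" for n
    have "(\<lambda>n. a - s n) \<longlonglongrightarrow> 0"
      by (rule Lim_null_comparison[OF _ LIMSEQ_inverse_real_of_nat])
        (use c in \<open>auto simp: s_def intro!: always_eventually less_imp_le simp del: of_nat_Suc\<close>)
    then have lim: "s \<longlonglongrightarrow> a"
      using tendsto_diff[OF tendsto_const[of a], of "\<lambda>n. a - s n" 0] by simp
    have Cau: "Cauchy s" using lim by (rule LIMSEQ_imp_Cauchy)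
    have "convergent (\<lambda>n. c n b)" if b: "b \<in> B" for b
    proof (rule Cauchy_convergent, rule metric_CauchyI)
      fix e :: real assume "e > 0"
      then obtain N where N: "\<And>m n. m \<ge> N \<Longrightarrow> n \<ge> N \<Longrightarrow> dist (s m) (s n) < e / C"
        using metric_CauchyD[OF Cau, of "e / C"] C(1) by auto
      have "dist (c m b) (c n b) < e" if "m \<ge> N" "n \<ge> N" for m n
      proof -
        have "\<bar>c m b - c n b\<bar> \<le> C * norm (\<Sum>b\<in>B. (c m b - c n b) *\<^sub>R b)"
          using C(2)[OF b, of "\<lambda>b. c m b - c n b"] by simp
        also have "\<dots> = C * dist (s m) (s n)"
          by (simp add: s_def dist_norm scaleR_diff_left sum_subtractf)
        also have "\<dots> < e" using N[OF that] C(1) by (simp add: field_simps)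
        finally show ?thesis by (simp add: dist_real_def)
      qed
      then show "\<exists>M. \<forall>m\<ge>M. \<forall>n\<ge>M. dist (c m b) (c n b) < e" by blast
    qed
    then have "s \<longlonglongrightarrow> (\<Sum>b\<in>B. lim (\<lambda>n. c n b) *\<^sub>R b)"
      unfolding s_def by (intro tendsto_sum tendsto_scaleR tendsto_const) (simp add: convergent_LIMSEQ_iff)
    then have "a = (\<Sum>b\<in>B. lim (\<lambda>n. c n b) *\<^sub>R b)" using lim LIMSEQ_unique by blast
    moreover have "(\<Sum>b\<in>B. lim (\<lambda>n. c n b) *\<^sub>R b) \<in> span B"
      by (intro span_sum span_scale span_base)
    ultimately show False using a by simp
  qed
  then obtain d where d: "d > 0" "\<And>c. d \<le> norm (a - (\<Sum>b\<in>B. c b *\<^sub>R b))" by blast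
  \<comment> \<open>\<open>1 / d\<close> bounds the coefficient of \<open>a\<close>; the second
    entry bounds those of \<open>B\<close>, since
    \<open>norm s \<le> norm t + \<bar>c a\<bar> * norm a\<close> and
    \<open>\<bar>c a\<bar> \<le> norm t / d\<close>.\<close>
  define K where "K = max (1 / d) (C * (1 + norm a / d))"
  have K: "K > 0" using d(1) by (simp add: K_def less_max_iff_disj)
  have "\<bar>c b\<bar> \<le> K * norm (\<Sum>b\<in>insert a B. c b *\<^sub>R b)" if b: "b \<in> insert a B" for c b
  proof -
    define s where "s = (\<Sum>b\<in>B. c b *\<^sub>R b)"
    define t where "t = c a *\<^sub>R a + s"
    have t: "(\<Sum>b\<in>insert a B. c b *\<^sub>R b) = t" using insert.hyps by (simp add: t_def s_def)
    have 1: "\<bar>c a\<bar> \<le> norm t / d"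
    proof (cases "c a = 0")
      case True then show ?thesis using d(1) by simp
    next
      case False
      have "d \<le> norm (a - (\<Sum>b\<in>B. (- c b / c a) *\<^sub>R b))" by (rule d(2))
      also have "a - (\<Sum>b\<in>B. (- c b / c a) *\<^sub>R b) = (1 / c a) *\<^sub>R t"
        using False by (simp add: t_def s_def scaleR_add_right scaleR_sum_right sum_negf)
      finally show ?thesis using False d(1) by (simp add: field_simps)
    qed
    have 2: "\<bar>c b'\<bar> \<le> C * (1 + norm a / d) * norm t" if "b' \<in> B" for b'
    proof -
      have "norm s \<le> norm t + \<bar>c a\<bar> * norm a"
        using norm_triangle_ineq4[of t "c a *\<^sub>R a"] by (simp add: t_def)
      also have "\<dots> \<le> norm t + norm t / d * norm a"
        using 1 by (intro add_left_mono mult_right_mono) auto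
      finally have "C * norm s \<le> C * (norm t + norm t / d * norm a)"
        using C(1) by (intro mult_left_mono) auto
      also have "\<dots> = C * (1 + norm a / d) * norm t"
        by (simp add: algebra_simps)
      finally have "C * norm s \<le> C * (1 + norm a / d) * norm t" .
      then show ?thesis using C(2)[OF that, of c] by (simp add: s_def)
    qed
    have "1 / d * norm t \<le> K * norm t" "C * (1 + norm a / d) * norm t \<le> K * norm t"
      unfolding K_def by (intro mult_right_mono; simp)+
    then show ?thesis using 1 2[of b] b unfolding t by auto
  qed
  then show ?case using K by blast
qed

definition finite_dim :: "'e::real_normed_vector itself \<Rightarrow> bool" where
  "finite_dim _ \<longleftrightarrow> (\<exists>B::'e set. finite B \<and> span B = UNIV)"

text \<open>Continuous functionals that reconstruct every vector: this is what writes a linear map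
  as a finite sum with well-behaved coefficients.\<close>

definition coordinates :: "'e::real_normed_vector set \<Rightarrow> ('e \<Rightarrow> 'e \<Rightarrow> real) \<Rightarrow> bool" where
  "coordinates B \<rho> \<longleftrightarrow> finite B \<and> (\<forall>b\<in>B. bounded_linear (\<rho> b)) \<and>
     (\<forall>x. (\<Sum>b\<in>B. \<rho> b x *\<^sub>R b) = x)"

lemma coordinatesD:
  assumes "coordinates B \<rho>"
  shows "b \<in> B \<Longrightarrow> bounded_linear (\<rho> b)" "(\<Sum>b\<in>B. \<rho> b x *\<^sub>R b) = x"
  using assms by (auto simp: coordinates_def)

text \<open>A finite spanning set contains a basis, and the coefficient bound makes the coefficients
  with respect to it bounded functionals.\<close>

lemma finite_dim_coordinates:
  assumes "finite_dim TYPE('e::real_normed_vector)"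
  obtains B :: "'e::real_normed_vector set" and \<rho> where "coordinates B \<rho>"
proof -
  obtain B0 :: "'e set" where B0: "finite B0" "span B0 = UNIV"
    using assms by (auto simp: finite_dim_def)
  obtain B where B: "B \<subseteq> B0" "independent B" "B0 \<subseteq> span B"
    by (metis real_vector.maximal_independent_subset)
  have fin: "finite B" using B B0 finite_subset by blast
  have sp: "span B = UNIV" using B(3) B0(2) by (metis span_minimal subspace_span top.extremum_uniqueI)
  obtain C where C: "C > 0" "\<And>c b. b \<in> B \<Longrightarrow> \<bar>c b\<bar> \<le> C * norm (\<Sum>b\<in>B. c b *\<^sub>R b)"
    using finite_independent_coefficients_bounded[OF fin B(2)] by blast
  define \<rho> where "\<rho> b x = representation B x b" for b x
  have sum: "(\<Sum>b\<in>B. \<rho> b x *\<^sub>R b) = x" for x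
    using real_vector.sum_representation_eq[OF B(2), of x B] fin sp by (simp add: \<rho>_def)
  have "bounded_linear (\<rho> b)" if "b \<in> B" for b
  proof (rule bounded_linear_intro[of _ C])
    show "\<rho> b (x + y) = \<rho> b x + \<rho> b y" for x y
      by (simp add: \<rho>_def real_vector.representation_add[OF B(2)] sp)
    show "\<rho> b (r *\<^sub>R x) = r *\<^sub>R \<rho> b x" for r x
      by (simp add: \<rho>_def real_vector.representation_scale[OF B(2)] sp)
    show "norm (\<rho> b x) \<le> norm x * C" for x
      using C(2)[OF that, of "\<lambda>b. \<rho> b x"] by (simp add: sum mult.commute)
  qed
  then have "coordinates B \<rho>" using fin sum by (simp add: coordinates_def)
  then show ?thesis by (rule that)
qed

text \<open>Some coordinate of a nonzero vector is nonzero. This supplies the functional in each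
  elimination step.\<close>

lemma finite_dim_functional:
  assumes "finite_dim TYPE('e::real_normed_vector)" "(w::'e) \<noteq> 0"
  obtains \<phi> :: "'e::real_normed_vector \<Rightarrow> real" where "bounded_linear \<phi>" "\<phi> w \<noteq> 0"
proof -
  obtain B :: "'e set" and \<rho> :: "'e \<Rightarrow> 'e \<Rightarrow> real"
    where B: "coordinates B \<rho>" by (rule finite_dim_coordinates[OF assms(1)])
  have "(\<Sum>b\<in>B. \<rho> b w *\<^sub>R b) \<noteq> 0"
    using coordinatesD(2)[OF B, of w] assms(2) by simp
  then obtain b where "b \<in> B" "\<rho> b w *\<^sub>R b \<noteq> 0"
    by (rule sum.not_neutral_contains_not_neutral)
  then show ?thesis using that[of "\<rho> b"] coordinatesD(1)[OF B] by simp
qed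

text \<open>Charts of a tangent bundle take values in \<open>'e \<times> 'e\<close>, so this is used
  at every passage to a tangent bundle.\<close>

lemma finite_dim_prod:
  assumes "finite_dim TYPE('e::real_normed_vector)" "finite_dim TYPE('f::real_normed_vector)"
  shows "finite_dim TYPE('e \<times> 'f)"
proof -
  obtain B :: "'e set" where B: "finite B" "span B = UNIV" using assms(1) by (auto simp: finite_dim_def)
  obtain C :: "'f set" where C: "finite C" "span C = UNIV" using assms(2) by (auto simp: finite_dim_def)
  define D where "D = (\<lambda>b. (b, 0::'f)) ` B \<union> (\<lambda>c. (0::'e, c)) ` C"
  have l1: "linear (\<lambda>b. (b::'e, 0::'f))" and l2: "linear (\<lambda>c. (0::'e, c::'f))"
    by (auto intro!: linearI)
  have "(x, y) \<in> span D" for x y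
  proof -
    have "(x, 0) \<in> span ((\<lambda>b. (b, 0::'f)) ` B)"
      using linear_span_image[OF l1, of B] B by auto
    moreover have "(0, y) \<in> span ((\<lambda>c. (0::'e, c)) ` C)"
      using linear_span_image[OF l2, of C] C by auto
    ultimately have "(x, 0) \<in> span D" "(0, y) \<in> span D"
      unfolding D_def by (meson span_mono subsetD sup_ge1 sup_ge2)+
    from span_add[OF this] show ?thesis by simp
  qed
  then show ?thesis using B C unfolding finite_dim_def
    by (intro exI[of _ D]) (auto simp: D_def)
qed

section \<open>Calculus of smooth functions\<close>

lemma Ck_on_cong:
  assumes "open U" "Ck_on k U f" "\<And>x. x \<in> U \<Longrightarrow> f x = g x"
  shows "Ck_on k U g"
  using assms(2,3)
proof (induction k arbitrary: f g)
  case 0 then show ?case by (auto cong: continuous_on_cong)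
next
  case (Suc k)
  have f: "(f has_derivative frechet_derivative f (at x)) (at x)" if "x \<in> U" for x
    using Suc.prems(1) that by (simp add: frechet_derivative_works)
  have g: "(g has_derivative frechet_derivative f (at x)) (at x)" if "x \<in> U" for x
    using has_derivative_transform_within_open[OF f[OF that] assms(1) that] Suc.prems(2) by blast
  then have "frechet_derivative f (at x) v = frechet_derivative g (at x) v" if "x \<in> U" for x v
    using frechet_derivative_at that by metis
  then have "Ck_on k U (\<lambda>x. frechet_derivative g (at x) v)" for v
    using Suc.IH[of "\<lambda>x. frechet_derivative f (at x) v" "\<lambda>x. frechet_derivative g (at x) v"] Suc.prems(1) by simp
  then show ?case using g by (auto simp: differentiable_def)
qed

text \<open>Derivatives are unique, so any explicit formula for the derivative may replace
  \<open>frechet_derivative\<close>. The closure lemmas supply such formulas.\<close>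

lemma Ck_on_SucI:
  assumes "open U" "\<And>x. x \<in> U \<Longrightarrow> (f has_derivative f' x) (at x)" "\<And>v. Ck_on k U (\<lambda>x. f' x v)"
  shows "Ck_on (Suc k) U f"
proof -
  have "Ck_on k U (\<lambda>x. frechet_derivative f (at x) v)" for v
    by (rule Ck_on_cong[OF assms(1) assms(3)[of v]]) (use assms(2) frechet_derivative_at in metis)
  then show ?thesis using assms(2) by (auto simp: differentiable_def)
qed

lemma Ck_on_Suc_derivative:
  assumes "Ck_on (Suc k) U f" "x \<in> U"
  shows "(f has_derivative frechet_derivative f (at x)) (at x)"
  using assms by (simp add: frechet_derivative_works)

text \<open>Derivatives of products and composites mix \<open>f\<close> with its derivatives, so
  inductions on \<open>k\<close> need \<open>f\<close> itself one order lower.\<close>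

lemma Ck_on_Suc_imp: "Ck_on (Suc k) U f \<Longrightarrow> Ck_on k U f"
proof (induction k arbitrary: f)
  case 0
  then show ?case
    by (auto intro!: differentiable_imp_continuous_on differentiable_at_imp_differentiable_on)
next
  case (Suc k)
  then show ?case by (auto simp del: Ck_on.simps simp add: Ck_on.simps(2)[of "Suc k"] Ck_on.simps(2)[of k])
qed

text \<open>Continuity and derivatives are local notions; this permits \<open>S\<close> to be
  examined with frames that exist only near a point.\<close>

lemma Ck_on_locally:
  assumes "\<And>x. x \<in> U \<Longrightarrow> \<exists>V. open V \<and> x \<in> V \<and> Ck_on k V f"
  shows "Ck_on k U f"
  using assms
proof (induction k arbitrary: f)
  case 0
  show ?case unfolding Ck_on.simps
  proof (rule continuous_at_imp_continuous_on, rule ballI)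
    fix x assume "x \<in> U"
    then show "isCont f x" using 0 by (metis Ck_on.simps(1) continuous_on_eq_continuous_at)
  qed
next
  case (Suc k)
  have "f differentiable at x" if "x \<in> U" for x using Suc.prems[OF that] by auto
  moreover have "Ck_on k U (\<lambda>x. frechet_derivative f (at x) v)" for v
    by (rule Suc.IH) (use Suc.prems in force)
  ultimately show ?case by simp
qed

lemma Ck_on_subset: "Ck_on k U f \<Longrightarrow> V \<subseteq> U \<Longrightarrow> Ck_on k V f"
  by (induction k arbitrary: f) (auto intro: continuous_on_subset)

lemma Ck_on_const: "open U \<Longrightarrow> Ck_on k U (\<lambda>_. c)"
  by (induction k arbitrary: c) auto

lemma Ck_on_bounded_linear:
  assumes h: "bounded_linear h" and U: "open U" and "Ck_on k U f"
  shows "Ck_on k U (\<lambda>x. h (f x))"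
  using assms(3)
proof (induction k arbitrary: f)
  case 0 then show ?case using bounded_linear.continuous_on[OF h] by auto
next
  case (Suc k)
  show ?case
  proof (rule Ck_on_SucI[OF U])
    show "((\<lambda>x. h (f x)) has_derivative (\<lambda>v. h (frechet_derivative f (at x) v))) (at x)" if "x \<in> U" for x
      using bounded_linear.has_derivative[OF h Ck_on_Suc_derivative[OF Suc.prems that]] .
  qed (use Suc in auto)
qed

lemma Ck_on_add:
  assumes U: "open U" and "Ck_on k U f" "Ck_on k U g"
  shows "Ck_on k U (\<lambda>x. f x + g x)"
  using assms(2,3)
proof (induction k arbitrary: f g)
  case 0 then show ?case by (auto intro: continuous_on_add)
next
  case (Suc k)
  show ?case
  proof (rule Ck_on_SucI[OF U])
    show "((\<lambda>x. f x + g x) has_derivative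
        (\<lambda>v. frechet_derivative f (at x) v + frechet_derivative g (at x) v)) (at x)" if "x \<in> U" for x
      by (intro has_derivative_add Ck_on_Suc_derivative[OF _ that]; fact)
  qed (use Suc in auto)
qed

lemma Ck_on_bilinear:
  assumes h: "bounded_bilinear h" and U: "open U" and "Ck_on k U f" "Ck_on k U g"
  shows "Ck_on k U (\<lambda>x. h (f x) (g x))"
  using assms(3,4)
proof (induction k arbitrary: f g)
  case 0 then show ?case by (auto intro: bounded_bilinear.continuous_on[OF h])
next
  case (Suc k)
  show ?case
  proof (rule Ck_on_SucI[OF U])
    show "((\<lambda>x. h (f x) (g x)) has_derivative
        (\<lambda>v. h (f x) (frechet_derivative g (at x) v) + h (frechet_derivative f (at x) v) (g x))) (at x)"
      if "x \<in> U" for x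
      by (intro bounded_bilinear.FDERIV[OF h] Ck_on_Suc_derivative[OF _ that]; fact)
    show "Ck_on k U (\<lambda>x. h (f x) (frechet_derivative g (at x) v) + h (frechet_derivative f (at x) v) (g x))" for v
      using Suc.prems Suc.prems[THEN Ck_on_Suc_imp] by (intro Ck_on_add[OF U] Suc.IH) simp_all
  qed
qed

lemma Ck_on_Pair:
  assumes U: "open U" and "Ck_on k U f" "Ck_on k U g"
  shows "Ck_on k U (\<lambda>x. (f x, g x))"
  using assms(2,3)
proof (induction k arbitrary: f g)
  case 0 then show ?case by (auto intro: continuous_on_Pair)
next
  case (Suc k)
  show ?case
  proof (rule Ck_on_SucI[OF U])
    show "((\<lambda>x. (f x, g x)) has_derivative
        (\<lambda>v. (frechet_derivative f (at x) v, frechet_derivative g (at x) v))) (at x)" if "x \<in> U" for x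
      by (intro has_derivative_Pair Ck_on_Suc_derivative[OF _ that]; fact)
  qed (use Suc in auto)
qed

lemma Ck_on_sum:
  assumes U: "open U" and "\<And>i. i \<in> I \<Longrightarrow> Ck_on k U (f i)"
  shows "Ck_on k U (\<lambda>x. \<Sum>i\<in>I. f i x)"
  using assms(2)
  by (induction I rule: infinite_finite_induct) (auto intro: Ck_on_const[OF U] Ck_on_add[OF U])

lemma Ck_on_inverse:
  fixes f :: "'e::real_normed_vector \<Rightarrow> real"
  assumes U: "open U" and "Ck_on k U f" and nz: "\<And>x. x \<in> U \<Longrightarrow> f x \<noteq> 0"
  shows "Ck_on k U (\<lambda>x. inverse (f x))"
  using assms(2)
proof (induction k)
  case 0 then show ?case using nz by (auto intro: continuous_on_inverse)
next
  case (Suc k)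
  show ?case
  proof (rule Ck_on_SucI[OF U])
    show "((\<lambda>x. inverse (f x)) has_derivative
        (\<lambda>v. - (inverse (f x) * frechet_derivative f (at x) v * inverse (f x)))) (at x)" if "x \<in> U" for x
      by (rule Deriv.has_derivative_inverse[OF nz[OF that] Ck_on_Suc_derivative[OF Suc.prems that]])
    \<comment> \<open>The derivative contains the reciprocal itself, which the induction hypothesis
      supplies at order \<open>k\<close>.\<close>
    have inv: "Ck_on k U (\<lambda>x. inverse (f x))" using Suc by (blast intro: Ck_on_Suc_imp)
    show "Ck_on k U (\<lambda>x. - (inverse (f x) * frechet_derivative f (at x) v * inverse (f x)))" for v
      using Suc.prems
      by (intro Ck_on_bounded_linear[OF bounded_linear_minus[OF bounded_linear_ident] U]
          Ck_on_bilinear[OF bounded_bilinear_mult U] inv) auto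
  qed
qed

text \<open>\<open>Ck_on\<close> gives regularity of the derivative in fixed directions only; this
  formula reduces a direction that varies with the point to finitely many fixed ones.\<close>

lemma frechet_derivative_coordinates:
  assumes "coordinates B \<rho>" "f differentiable (at x)"
  shows "frechet_derivative f (at x) w = (\<Sum>b\<in>B. \<rho> b w *\<^sub>R frechet_derivative f (at x) b)"
proof -
  have l: "linear (frechet_derivative f (at x))" by (rule linear_frechet_derivative[OF assms(2)])
  have "frechet_derivative f (at x) (\<Sum>b\<in>B. \<rho> b w *\<^sub>R b) = (\<Sum>b\<in>B. \<rho> b w *\<^sub>R frechet_derivative f (at x) b)"
    by (simp add: linear_sum[OF l] linear_cmul[OF l])
  then show ?thesis by (simp add: coordinatesD(2)[OF assms(1)])
qed

text \<open>The chain rule differentiates \<open>g\<close> in a direction moving with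
  \<open>x\<close>. Expanded in coordinates, the derivative is a sum of products of real coordinates
  with fixed-direction derivatives of \<open>g\<close> composed with \<open>f\<close>, and the
  induction hypothesis applies to the latter.\<close>

lemma Ck_on_compose:
  assumes fd: "finite_dim TYPE('f::real_normed_vector)"
    and U: "open U" and "Ck_on k U (f :: 'e::real_normed_vector \<Rightarrow> 'f)" "Ck_on k V g" "f ` U \<subseteq> V"
  shows "Ck_on k U (\<lambda>x. g (f x))"
  using assms(3,4)
proof (induction k arbitrary: g)
  case 0 then show ?case using assms(5) by (auto intro: continuous_on_compose2)
next
  case (Suc k)
  obtain B :: "'f set" and \<rho> :: "'f \<Rightarrow> 'f \<Rightarrow> real"
    where B: "coordinates B \<rho>" by (rule finite_dim_coordinates[OF fd])
  have g: "(g has_derivative frechet_derivative g (at (f x))) (at (f x))" if "x \<in> U" for x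
    using Ck_on_Suc_derivative[OF Suc.prems(2)] assms(5) that by blast
  show ?case
  proof (rule Ck_on_SucI[OF U])
    show "((\<lambda>x. g (f x)) has_derivative (\<lambda>v. \<Sum>b\<in>B. \<rho> b (frechet_derivative f (at x) v)
        *\<^sub>R frechet_derivative g (at (f x)) b)) (at x)" if "x \<in> U" for x
      unfolding frechet_derivative_coordinates[OF B differentiableI[OF g[OF that]], symmetric]
      using has_derivative_compose[OF Ck_on_Suc_derivative[OF Suc.prems(1) that] g[OF that]] .
    have f: "Ck_on k U f" using Suc.prems by (blast intro: Ck_on_Suc_imp)
    show "Ck_on k U (\<lambda>x. \<Sum>b\<in>B. \<rho> b (frechet_derivative f (at x) v)
        *\<^sub>R frechet_derivative g (at (f x)) b)" for v
    proof (intro Ck_on_sum[OF U] Ck_on_bilinear[OF bounded_bilinear_scaleR U])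
      fix b assume "b \<in> B"
      show "Ck_on k U (\<lambda>x. \<rho> b (frechet_derivative f (at x) v))"
        using Suc.prems(1) by (intro Ck_on_bounded_linear[OF coordinatesD(1)[OF B \<open>b \<in> B\<close>] U]) simp
      show "Ck_on k U (\<lambda>x. frechet_derivative g (at (f x)) b)"
        using Suc.prems(2) by (intro Suc.IH[OF f]) simp
    qed
  qed
qed

section \<open>The corresponding rules for smooth functions\<close>

lemma smooth_on_cong:
  "open U \<Longrightarrow> smooth_on U f \<Longrightarrow> (\<And>x. x \<in> U \<Longrightarrow> f x = g x) \<Longrightarrow> smooth_on U g"
  unfolding smooth_on_def using Ck_on_cong by blast

lemma smooth_on_locally:
  "(\<And>x. x \<in> U \<Longrightarrow> \<exists>V. open V \<and> x \<in> V \<and> smooth_on V f) \<Longrightarrow> smooth_on U f"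
  unfolding smooth_on_def using Ck_on_locally by meson

lemma smooth_on_subset: "smooth_on U f \<Longrightarrow> V \<subseteq> U \<Longrightarrow> smooth_on V f"
  unfolding smooth_on_def using Ck_on_subset by blast

lemma smooth_on_bounded_linear:
  "bounded_linear h \<Longrightarrow> open U \<Longrightarrow> smooth_on U f \<Longrightarrow> smooth_on U (\<lambda>x. h (f x))"
  unfolding smooth_on_def using Ck_on_bounded_linear by blast

lemma smooth_on_ident: "open U \<Longrightarrow> smooth_on U (\<lambda>x. x)"
proof -
  assume U: "open U"
  have "Ck_on k U (\<lambda>x. x)" for k by (cases k) (auto intro: Ck_on_const[OF U])
  then show ?thesis by (simp add: smooth_on_def)
qed

lemma smooth_on_add:
  "open U \<Longrightarrow> smooth_on U f \<Longrightarrow> smooth_on U g \<Longrightarrow> smooth_on U (\<lambda>x. f x + g x)"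
  unfolding smooth_on_def using Ck_on_add by blast

lemma smooth_on_diff:
  assumes "open U" "smooth_on U f" "smooth_on U g"
  shows "smooth_on U (\<lambda>x. f x - g x)"
  using smooth_on_add[OF assms(1,2)
      smooth_on_bounded_linear[OF bounded_linear_minus[OF bounded_linear_ident] assms(1,3)]]
  by simp

lemma smooth_on_scaleR:
  "open U \<Longrightarrow> smooth_on U f \<Longrightarrow> smooth_on U g \<Longrightarrow> smooth_on U (\<lambda>x. f x *\<^sub>R g x)"
  unfolding smooth_on_def using Ck_on_bilinear[OF bounded_bilinear_scaleR] by blast

lemma smooth_on_Pair:
  "open U \<Longrightarrow> smooth_on U f \<Longrightarrow> smooth_on U g \<Longrightarrow> smooth_on U (\<lambda>x. (f x, g x))"
  unfolding smooth_on_def using Ck_on_Pair by blast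

lemma smooth_on_sum:
  "open U \<Longrightarrow> (\<And>i. i \<in> I \<Longrightarrow> smooth_on U (f i)) \<Longrightarrow> smooth_on U (\<lambda>x. \<Sum>i\<in>I. f i x)"
  unfolding smooth_on_def using Ck_on_sum[of U I] by metis

lemma smooth_on_inverse:
  fixes f :: "'e::real_normed_vector \<Rightarrow> real"
  shows "open U \<Longrightarrow> smooth_on U f \<Longrightarrow> (\<And>x. x \<in> U \<Longrightarrow> f x \<noteq> 0) \<Longrightarrow> smooth_on U (\<lambda>x. inverse (f x))"
  unfolding smooth_on_def using Ck_on_inverse by blast

lemma smooth_on_compose:
  assumes "finite_dim TYPE('f::real_normed_vector)" "open U"
    and "smooth_on U (f :: 'e::real_normed_vector \<Rightarrow> 'f)" "smooth_on V g" "f ` U \<subseteq> V"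
  shows "smooth_on U (\<lambda>x. g (f x))"
  using assms unfolding smooth_on_def by (metis Ck_on_compose)

lemma smooth_on_continuous: "smooth_on U f \<Longrightarrow> continuous_on U f"
  unfolding smooth_on_def by (metis Ck_on.simps(1))

lemma smooth_on_differentiable: "smooth_on U f \<Longrightarrow> x \<in> U \<Longrightarrow> f differentiable (at x)"
  unfolding smooth_on_def by (metis Ck_on.simps(2))

text \<open>Joint smoothness in base point and direction; this is the form taken by the fibre part
  of a transition between tangent charts.\<close>

lemma smooth_on_frechet_derivative:
  assumes fd: "finite_dim TYPE('e::real_normed_vector)"
    and U: "open U" and f: "smooth_on V (f :: 'e \<Rightarrow> 'f::real_normed_vector)"
    and g: "smooth_on U g" and g': "smooth_on U g'" and sub: "g ` U \<subseteq> V"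
  shows "smooth_on U (\<lambda>x. frechet_derivative f (at (g x)) (g' x))"
proof -
  obtain B :: "'e set" and \<rho> :: "'e \<Rightarrow> 'e \<Rightarrow> real"
    where B: "coordinates B \<rho>" by (rule finite_dim_coordinates[OF fd])
  have "smooth_on V (\<lambda>x. frechet_derivative f (at x) b)" for b
    using f unfolding smooth_on_def by (metis Ck_on.simps(2))
  then have "smooth_on U (\<lambda>x. \<Sum>b\<in>B. \<rho> b (g' x) *\<^sub>R frechet_derivative f (at (g x)) b)"
    by (intro smooth_on_sum[OF U] smooth_on_scaleR[OF U] smooth_on_bounded_linear[OF coordinatesD(1)[OF B] U g']
        smooth_on_compose[OF fd U g _ sub])
  then show ?thesis
  proof (rule smooth_on_cong[OF U])
    show "(\<Sum>b\<in>B. \<rho> b (g' x) *\<^sub>R frechet_derivative f (at (g x)) b) = frechet_derivative f (at (g x)) (g' x)"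
      if "x \<in> U" for x
    proof -
      have "g x \<in> V" using sub that by auto
      from frechet_derivative_coordinates[OF B smooth_on_differentiable[OF f this], of "g' x"]
      show ?thesis by simp
    qed
  qed
qed

text \<open>The functionals are built by elimination, one frame vector at a time: \<open>P z\<close> below projects along
  the first \<open>k\<close> frame vectors, and \<open>\<phi> \<circ> P z\<close>, normalised near \<open>z0\<close>, is the next functional. Smoothness
  is required of \<open>L i z (g z)\<close> for all smooth \<open>g\<close> so that it can be applied to the frame itself.\<close>

lemma smooth_dual_frame:
  fixes X :: "nat \<Rightarrow> 'z::real_normed_vector \<Rightarrow> 'e::real_normed_vector"
  assumes fd: "finite_dim TYPE('e)" and U: "open U" "z0 \<in> U"
    and "\<And>i. i < k \<Longrightarrow> smooth_on U (X i)"
    and "\<And>a. (\<Sum>i<k. a i *\<^sub>R X i z0) = 0 \<Longrightarrow> \<forall>i<k. a i = 0"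
  shows "\<exists>V L. open V \<and> z0 \<in> V \<and> V \<subseteq> U \<and>
     (\<forall>i<k. (\<forall>z\<in>V. linear (L i z) \<and> (\<forall>j<k. L i z (X j z) = (if i = j then 1 else 0 :: real))) \<and>
            (\<forall>W g. open W \<and> W \<subseteq> V \<and> smooth_on W g \<longrightarrow> smooth_on W (\<lambda>z. L i z (g z))))"
  using assms(4,5)
proof (induction k)
  case 0 then show ?case using U by auto
next
  case (Suc k)
  have "\<forall>i<k. a i = 0" if "(\<Sum>i<k. a i *\<^sub>R X i z0) = 0" for a
  proof -
    \<comment> \<open>A relation among the first \<open>k\<close> vectors is padded with the
      coefficient 0 at \<open>k\<close>.\<close>
    have "(\<Sum>i<k. (a(k := 0)) i *\<^sub>R X i z0) = (\<Sum>i<k. a i *\<^sub>R X i z0)" by (rule sum.cong) auto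
    then have "(\<Sum>i<Suc k. (a(k := 0)) i *\<^sub>R X i z0) = 0" using that by simp
    from Suc.prems(2)[OF this] have "(a(k := 0)) i = 0" if "i < Suc k" for i using that by blast
    then show ?thesis by (metis fun_upd_other less_SucI less_irrefl)
  qed
  with Suc have "\<exists>V L. open V \<and> z0 \<in> V \<and> V \<subseteq> U \<and>
     (\<forall>i<k. (\<forall>z\<in>V. linear (L i z) \<and> (\<forall>j<k. L i z (X j z) = (if i = j then 1 else 0 :: real))) \<and>
            (\<forall>W g. open W \<and> W \<subseteq> V \<and> smooth_on W g \<longrightarrow> smooth_on W (\<lambda>z. L i z (g z))))"
    by simp
  then obtain V and L :: "nat \<Rightarrow> 'z \<Rightarrow> 'e \<Rightarrow> real" where V: "open V" "z0 \<in> V" "V \<subseteq> U"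
    and L: "\<forall>i<k. (\<forall>z\<in>V. linear (L i z) \<and> (\<forall>j<k. L i z (X j z) = (if i = j then 1 else 0))) \<and>
            (\<forall>W g. open W \<and> W \<subseteq> V \<and> smooth_on W g \<longrightarrow> smooth_on W (\<lambda>z. L i z (g z)))"
    by blast
  have lin: "linear (L i z)" if "i < k" "z \<in> V" for i z
    using L that by blast
  have dual: "L i z (X j z) = (if i = j then 1 else 0)" if "i < k" "j < k" "z \<in> V" for i j z
    using L that by blast
  have sm: "smooth_on W (\<lambda>z. L i z (g z))" if "i < k" "open W" "W \<subseteq> V" "smooth_on W g" for i W g
    using L that by blast
  define P where "P z e = e - (\<Sum>i<k. L i z e *\<^sub>R X i z)" for z e
  have linP: "linear (P z)" if "z \<in> V" for z
    by (rule linearI)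
      (use that in \<open>auto simp: P_def linear_add[OF lin] linear_cmul[OF lin] algebra_simps sum.distrib scaleR_sum_right\<close>)
  have smP: "smooth_on W (\<lambda>z. P z (g z))" if "open W" "W \<subseteq> V" "smooth_on W g" for W g
  proof -
    have "smooth_on W (X i)" if "i < k" for i
      using smooth_on_subset[OF Suc.prems(1)] \<open>W \<subseteq> V\<close> V(3) that by simp
    then show ?thesis
      unfolding P_def using that by (intro smooth_on_diff smooth_on_sum smooth_on_scaleR sm) auto
  qed
  have PX: "P z (X j z) = 0" if "z \<in> V" "j < k" for z j
  proof -
    have "(\<Sum>i<k. L i z (X j z) *\<^sub>R X i z) = (\<Sum>i<k. if i = j then X i z else 0)"
      by (rule sum.cong) (use that dual in auto)
    then show ?thesis using that by (simp add: P_def)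
  qed
  \<comment> \<open>Otherwise \<open>X k z0\<close> would be a combination of the earlier frame
    vectors; \<open>a\<close> is the resulting relation, with coefficient 1 at
    \<open>k\<close>.\<close>
  have "P z0 (X k z0) \<noteq> 0"
  proof
    assume "P z0 (X k z0) = 0"
    define a where "a i = (if i = k then 1 else - L i z0 (X k z0))" for i
    have "(\<Sum>i<k. a i *\<^sub>R X i z0) = (\<Sum>i<k. - (L i z0 (X k z0) *\<^sub>R X i z0))"
      by (rule sum.cong) (auto simp: a_def)
    then have "(\<Sum>i<Suc k. a i *\<^sub>R X i z0) = P z0 (X k z0)"
      by (simp add: a_def P_def sum_negf)
    then have "a k = 0" using Suc.prems(2) \<open>P z0 (X k z0) = 0\<close> by auto
    then show False by (simp add: a_def)
  qed
  then obtain \<phi> :: "'e \<Rightarrow> real" where \<phi>: "bounded_linear \<phi>" "\<phi> (P z0 (X k z0)) \<noteq> 0"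
    using finite_dim_functional[OF fd] by blast
  define r where "r z = \<phi> (P z (X k z))" for z
  have smr: "smooth_on V r"
    unfolding r_def using Suc.prems(1)[of k] V
    by (intro smooth_on_bounded_linear[OF \<phi>(1)] smP) (auto intro: smooth_on_subset)
  \<comment> \<open>By the choice of \<open>\<phi>\<close>, \<open>r\<close> is nonzero at
    \<open>z0\<close>, hence near it; dividing by \<open>r\<close> gives \<open>M\<close> the value
    1 on \<open>X k\<close>.\<close>
  define V' where "V' = {z \<in> V. r z \<noteq> 0}"
  have "V' = V \<inter> r -` (- {0})" by (auto simp: V'_def)
  then have V': "open V'" "z0 \<in> V'" "V' \<subseteq> V"
    using continuous_open_preimage[OF smooth_on_continuous[OF smr] V(1), of "- {0}"] V \<phi>(2)
    by (auto simp: r_def V'_def)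
  define M where "M z e = inverse (r z) *\<^sub>R \<phi> (P z e)" for z e
  have linM: "linear (M z)" if "z \<in> V'" for z
    using that V' linP[of z] \<phi>(1)
    by (intro linearI) (auto simp: M_def linear_add linear_cmul bounded_linear.linear algebra_simps)
  have smM: "smooth_on W (\<lambda>z. M z (g z))" if "open W" "W \<subseteq> V'" "smooth_on W g" for W g
    unfolding M_def using that V' 
    by (intro smooth_on_scaleR smooth_on_inverse smooth_on_bounded_linear[OF \<phi>(1)] smP)
      (auto intro: smooth_on_subset[OF smr] simp: V'_def)
  have MX: "M z (X j z) = (if j = k then 1 else 0)" if "z \<in> V'" "j < Suc k" for z j
    using that V' PX[of z j] linear_0[OF bounded_linear.linear[OF \<phi>(1)]]
    by (auto simp: M_def r_def V'_def)
  \<comment> \<open>\<open>M\<close> vanishes on the earlier frame vectors, so subtracting its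
    multiple kills the value of \<open>L i\<close> on \<open>X k\<close> and leaves the values on
    the others unchanged.\<close>
  define L' where "L' i z e = (if i = k then M z e else L i z e - L i z (X k z) *\<^sub>R M z e)" for i z e
  have "linear (L' i z)" if "z \<in> V'" "i < Suc k" for i z
    using that V' linM[of z] lin[of i z]
    by (intro linearI) (auto simp: L'_def linear_add linear_cmul algebra_simps)
  moreover have "L' i z (X j z) = (if i = j then 1 else 0)" if "z \<in> V'" "i < Suc k" "j < Suc k" for i j z
    using that V' MX[of z j] dual[of i j z] by (auto simp: L'_def less_Suc_eq)
  moreover have "smooth_on W (\<lambda>z. L' i z (g z))"
    if "i < Suc k" "open W" "W \<subseteq> V'" "smooth_on W g" for i W g
  proof (cases "i = k")
    case True then show ?thesis using smM[OF that(2-4)] by (simp add: L'_def)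
  next
    case False
    have "smooth_on W (X k)" using Suc.prems(1)[of k] V V' that by (auto intro: smooth_on_subset)
    then have "smooth_on W (\<lambda>z. L i z (g z) - L i z (X k z) *\<^sub>R M z (g z))"
      using that False V' by (intro smooth_on_diff smooth_on_scaleR sm smM) auto
    then show ?thesis using False by (simp add: L'_def)
  qed
  ultimately show ?case using V' V by (intro exI[of _ V'] exI[of _ L']) auto
qed

section \<open>Tangent bundles of atlases\<close>

text \<open>Both properties pass from \<open>A\<close> to \<open>tangent_atlas A\<close>, so the
  facts proved for TM can be reused for TTM.\<close>

locale finite_dim_atlas =
  fixes A :: "('a, 'e::real_normed_vector) chart set"
  assumes fd: "finite_dim TYPE('e)" and atlas: "smooth_atlas A"
begin

lemma inj_chart: "c \<in> A \<Longrightarrow> inj_on (snd c) (fst c)"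
  using atlas by (simp add: smooth_atlas_def)

lemma open_chart_image: "c \<in> A \<Longrightarrow> open (snd c ` fst c)"
  using atlas by (simp add: smooth_atlas_def)

lemma open_overlap: "c \<in> A \<Longrightarrow> d \<in> A \<Longrightarrow> open (snd c ` (fst c \<inter> fst d))"
  using atlas by (simp add: smooth_atlas_def)

lemma smooth_transition:
  "c \<in> A \<Longrightarrow> d \<in> A \<Longrightarrow> smooth_on (snd c ` (fst c \<inter> fst d)) (transition c d)"
  using atlas by (simp add: smooth_atlas_def)

lemma chart_inv_chart [simp]: "c \<in> A \<Longrightarrow> p \<in> fst c \<Longrightarrow> chart_inv c (snd c p) = p"
  by (simp add: chart_inv_def inj_chart)

lemma transition_chart [simp]: "c \<in> A \<Longrightarrow> p \<in> fst c \<Longrightarrow> transition c d (snd c p) = snd d p"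
  by (simp add: transition_def)

lemmas openin_iff = openin_atlas_topology[OF atlas]

lemma openin_carrier: "openin (atlas_topology A) (carrier_of A)"
proof -
  have "carrier_of A \<inter> fst c = fst c" if "c \<in> A" for c using that by (auto simp: carrier_of_def)
  then show ?thesis by (simp add: openin_iff open_chart_image)
qed

lemma topspace_atlas: "topspace (atlas_topology A) = carrier_of A"
proof
  show "topspace (atlas_topology A) \<subseteq> carrier_of A"
    using openin_topspace[of "atlas_topology A"] by (simp only: openin_iff)
qed (rule openin_subset[OF openin_carrier])

lemma open_image_openin:
  "openin (atlas_topology A) W \<Longrightarrow> c \<in> A \<Longrightarrow> open (snd c ` (W \<inter> fst c))"
  by (simp add: openin_iff)

lemma chart_image_Int:
  "c \<in> A \<Longrightarrow> X \<subseteq> fst c \<Longrightarrow> Y \<subseteq> fst c \<Longrightarrow> snd c ` (X \<inter> Y) = snd c ` X \<inter> snd c ` Y"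
  using inj_on_image_Int[OF inj_chart] by blast

lemma open_triple_overlap:
  assumes "c \<in> A" "d \<in> A" "d' \<in> A"
  shows "open (snd c ` (fst c \<inter> fst d \<inter> fst d'))"
proof -
  have "fst c \<inter> fst d \<inter> fst d' = (fst c \<inter> fst d) \<inter> (fst c \<inter> fst d')" by blast
  then show ?thesis
    using assms chart_image_Int[of c "fst c \<inter> fst d" "fst c \<inter> fst d'"] by (simp add: open_Int open_overlap)
qed

section \<open>Derivatives of transition maps\<close>

lemma has_derivative_transition:
  assumes "c \<in> A" "d \<in> A" "p \<in> fst c" "p \<in> fst d"
  shows "(transition c d has_derivative frechet_derivative (transition c d) (at (snd c p))) (at (snd c p))"
  unfolding frechet_derivative_works[symmetric]
  by (rule smooth_on_differentiable[OF smooth_transition]) (use assms in auto)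

lemma derivative_transition_self:
  assumes "c \<in> A" "p \<in> fst c"
  shows "frechet_derivative (transition c c) (at (snd c p)) = (\<lambda>x. x)"
proof -
  have "(transition c c has_derivative (\<lambda>x. x)) (at (snd c p))"
    by (rule has_derivative_transform_within_open[OF has_derivative_ident open_chart_image[OF assms(1)]])
      (use assms in auto)
  from frechet_derivative_at[OF this] show ?thesis by simp
qed

text \<open>Chain rule for the cocycle identity of transition maps. That identity holds on the image
  of the triple overlap, whose openness lets it pass to derivatives.\<close>

lemma derivative_transition_comp:
  assumes "c \<in> A" "d \<in> A" "d' \<in> A" "p \<in> fst c" "p \<in> fst d" "p \<in> fst d'"
  shows "frechet_derivative (transition d d') (at (snd d p)) (frechet_derivative (transition c d) (at (snd c p)) e)
    = frechet_derivative (transition c d') (at (snd c p)) e"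
proof -
  have "((\<lambda>x. transition d d' (transition c d x)) has_derivative
      (\<lambda>e. frechet_derivative (transition d d') (at (snd d p))
        (frechet_derivative (transition c d) (at (snd c p)) e))) (at (snd c p))"
    using assms has_derivative_compose[OF has_derivative_transition[of c d p], of "transition d d'"]
      has_derivative_transition[of d d' p] by simp
  then have "(transition c d' has_derivative
      (\<lambda>e. frechet_derivative (transition d d') (at (snd d p))
        (frechet_derivative (transition c d) (at (snd c p)) e))) (at (snd c p))"
    by (rule has_derivative_transform_within_open[OF _ open_triple_overlap[of c d d']])
      (use assms in auto)
  from frechet_derivative_at[OF this] show ?thesis by metis
qed

section \<open>Tangent vectors in charts\<close>

lemma tangent_bundle_iff:
  "v \<in> TM A \<longleftrightarrow> fst v \<in> carrier_of A \<and>
     (\<forall>c\<in>A. \<forall>d\<in>A. fst v \<in> fst c \<inter> fst d \<longrightarrow>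
        snd v d = frechet_derivative (transition c d) (at (snd c (fst v))) (snd v c)) \<and>
     (\<forall>c. \<not> (c \<in> A \<and> fst v \<in> fst c) \<longrightarrow> snd v c = 0)"
  by (simp only: tangent_bundle_def case_prod_unfold mem_Collect_eq)

lemma tangent_bundleD:
  assumes "v \<in> TM A"
  shows "fst v \<in> carrier_of A"
    and "c \<in> A \<Longrightarrow> d \<in> A \<Longrightarrow> fst v \<in> fst c \<Longrightarrow> fst v \<in> fst d \<Longrightarrow>
      snd v d = frechet_derivative (transition c d) (at (snd c (fst v))) (snd v c)"
    and "\<not> (c \<in> A \<and> fst v \<in> fst c) \<Longrightarrow> snd v c = 0"
  using assms unfolding tangent_bundle_iff by blast+

lemma tangent_bundleI:
  assumes "fst v \<in> carrier_of A"
    and "\<And>c d. c \<in> A \<Longrightarrow> d \<in> A \<Longrightarrow> fst v \<in> fst c \<Longrightarrow> fst v \<in> fst d \<Longrightarrow>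
      snd v d = frechet_derivative (transition c d) (at (snd c (fst v))) (snd v c)"
    and "\<And>c. \<not> (c \<in> A \<and> fst v \<in> fst c) \<Longrightarrow> snd v c = 0"
  shows "v \<in> TM A"
  using assms unfolding tangent_bundle_iff by blast

text \<open>One chart determines the coordinate vectors in all other charts around the point through
  the transition derivatives; at all remaining arguments both families are 0.\<close>

lemma tangent_vector_eqI:
  assumes v: "v \<in> TM A" and w: "w \<in> TM A" and eq: "fst v = fst w" "snd v c = snd w c"
    and c: "c \<in> A" "fst v \<in> fst c"
  shows "v = w"
proof (rule prod_eqI[OF eq(1)], rule ext)
  fix d show "snd v d = snd w d"
  proof (cases "d \<in> A \<and> fst v \<in> fst d")
    case True
    then show ?thesis
      using tangent_bundleD(2)[OF v c(1) _ c(2)] tangent_bundleD(2)[OF w c(1), of d] c eq by simp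
  next
    case False
    then show ?thesis using tangent_bundleD(3)[OF v] tangent_bundleD(3)[OF w] eq(1) by simp
  qed
qed

text \<open>Transporting \<open>e\<close> to the other charts by the transition derivatives gives a
  consistent family, by the cocycle identity for these derivatives.\<close>

lemma tangent_vector_exists:
  assumes "c \<in> A" "p \<in> fst c"
  shows "\<exists>\<xi>. (p, \<xi>) \<in> TM A \<and> \<xi> c = e"
proof -
  define \<xi> where "\<xi> d = (if d \<in> A \<and> p \<in> fst d
    then frechet_derivative (transition c d) (at (snd c p)) e else 0)" for d
  have "(p, \<xi>) \<in> TM A"
    using assms derivative_transition_comp[OF assms(1) _ _ assms(2)]
    by (intro tangent_bundleI) (auto simp: \<xi>_def carrier_of_def)
  moreover have "\<xi> c = e" using assms by (simp add: \<xi>_def derivative_transition_self)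
  ultimately show ?thesis by blast
qed

lemma linear_derivative_transition:
  "c \<in> A \<Longrightarrow> d \<in> A \<Longrightarrow> p \<in> fst c \<Longrightarrow> p \<in> fst d \<Longrightarrow>
    linear (frechet_derivative (transition c d) (at (snd c p)))"
  using has_derivative_transition has_derivative_linear by blast

lemma subspace_tangent_fibre:
  assumes "p \<in> carrier_of A"
  shows "subspace (fibre (TM A) p)"
  unfolding subspace_def
proof (intro conjI ballI allI)
  show "0 \<in> fibre (TM A) p"
    unfolding fibre_def mem_Collect_eq
    by (rule tangent_bundleI) (simp_all add: assms linear_0[OF linear_derivative_transition])
  show "\<xi> + \<eta> \<in> fibre (TM A) p" if "\<xi> \<in> fibre (TM A) p" "\<eta> \<in> fibre (TM A) p" for \<xi> \<eta>
  proof -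
    have m: "(p, \<xi>) \<in> TM A" "(p, \<eta>) \<in> TM A" using that by (simp_all add: fibre_def)
    show ?thesis unfolding fibre_def mem_Collect_eq
    proof (rule tangent_bundleI)
      fix c d assume "c \<in> A" "d \<in> A" "fst (p, \<xi> + \<eta>) \<in> fst c" "fst (p, \<xi> + \<eta>) \<in> fst d"
      then show "snd (p, \<xi> + \<eta>) d = frechet_derivative (transition c d)
          (at (snd c (fst (p, \<xi> + \<eta>)))) (snd (p, \<xi> + \<eta>) c)"
        using tangent_bundleD(2)[OF m(1), of c d] tangent_bundleD(2)[OF m(2), of c d]
        by (simp add: linear_add[OF linear_derivative_transition])
    qed (use assms tangent_bundleD(3)[OF m(1)] tangent_bundleD(3)[OF m(2)] in auto)
  qed
  show "r *\<^sub>R \<xi> \<in> fibre (TM A) p" if "\<xi> \<in> fibre (TM A) p" for r \<xi>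
  proof -
    have m: "(p, \<xi>) \<in> TM A" using that by (simp add: fibre_def)
    show ?thesis unfolding fibre_def mem_Collect_eq
    proof (rule tangent_bundleI)
      fix c d assume "c \<in> A" "d \<in> A" "fst (p, r *\<^sub>R \<xi>) \<in> fst c" "fst (p, r *\<^sub>R \<xi>) \<in> fst d"
      then show "snd (p, r *\<^sub>R \<xi>) d = frechet_derivative (transition c d)
          (at (snd c (fst (p, r *\<^sub>R \<xi>)))) (snd (p, r *\<^sub>R \<xi>) c)"
        using tangent_bundleD(2)[OF m, of c d]
        by (simp add: scaleR_fun_def linear_cmul[OF linear_derivative_transition])
    qed (use assms tangent_bundleD(3)[OF m] in \<open>auto simp: scaleR_fun_def\<close>)
  qed
qed

section \<open>The tangent bundle as a manifold\<close>

lemma tangent_chart_simps [simp]: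
  "fst (tangent_chart A c) = {v \<in> TM A. fst v \<in> fst c}"
  "snd (tangent_chart A c) v = (snd c (fst v), snd v c)"
  by (simp_all add: tangent_chart_def)

text \<open>Every vector occurs as a fibre coordinate, so images are full cylinders and their
  openness reduces to that of chart images of \<open>A\<close>.\<close>

lemma tangent_chart_image:
  assumes "c \<in> A" "X \<subseteq> fst c"
  shows "snd (tangent_chart A c) ` {v \<in> TM A. fst v \<in> X} = (snd c ` X) \<times> UNIV"
proof
  show "snd c ` X \<times> UNIV \<subseteq> snd (tangent_chart A c) ` {v \<in> TM A. fst v \<in> X}"
  proof
    fix z assume "z \<in> snd c ` X \<times> (UNIV :: 'e set)"
    then obtain p e where p: "p \<in> X" and z: "z = (snd c p, e)" by auto
    obtain \<xi> where "(p, \<xi>) \<in> TM A" "\<xi> c = e" using tangent_vector_exists assms p by blast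
    then show "z \<in> snd (tangent_chart A c) ` {v \<in> TM A. fst v \<in> X}"
      using p z by (intro image_eqI[of _ _ "(p, \<xi>)"]) auto
  qed
qed auto

lemma carrier_of_tangent_atlas: "carrier_of (tangent_atlas A) = TM A"
  using tangent_bundleD(1) by (auto simp: carrier_of_def tangent_atlas_def)

lemma inj_tangent_chart: "c \<in> A \<Longrightarrow> inj_on (snd (tangent_chart A c)) (fst (tangent_chart A c))"
proof (rule inj_onI)
  fix v w assume c: "c \<in> A" and vw: "v \<in> fst (tangent_chart A c)" "w \<in> fst (tangent_chart A c)"
    "snd (tangent_chart A c) v = snd (tangent_chart A c) w"
  then have "fst v = fst w" using inj_onD[OF inj_chart[OF c], of "fst v" "fst w"] by simp
  then show "v = w" using vw c by (intro tangent_vector_eqI[of v w c]) auto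
qed

lemma chart_inv_tangent_chart:
  assumes "c \<in> A" "v \<in> TM A" "fst v \<in> fst c"
  shows "chart_inv (tangent_chart A c) (snd c (fst v), snd v c) = v"
  using assms inv_into_f_f[OF inj_tangent_chart[OF assms(1)], of v] by (simp add: chart_inv_def)

lemma tangent_chart_point:
  assumes "c \<in> A" "X \<subseteq> fst c" "z \<in> (snd c ` X) \<times> UNIV"
  obtains v where "v \<in> TM A" "fst v \<in> X" "z = (snd c (fst v), snd v c)"
  using assms(3) unfolding tangent_chart_image[OF assms(1,2), symmetric] by auto

text \<open>The second component is exactly the compatibility condition imposed on tangent
  vectors.\<close>

lemma tangent_transition:
  assumes "c \<in> A" "d \<in> A" "z \<in> (snd c ` (fst c \<inter> fst d)) \<times> UNIV"
  shows "transition (tangent_chart A c) (tangent_chart A d) z =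
    (transition c d (fst z), frechet_derivative (transition c d) (at (fst z)) (snd z))"
proof -
  obtain v where v: "v \<in> TM A" "fst v \<in> fst c \<inter> fst d" "z = (snd c (fst v), snd v c)"
    using tangent_chart_point[OF assms(1) Int_lower1 assms(3)] .
  then show ?thesis
    using assms chart_inv_tangent_chart[of c v] tangent_bundleD(2)[OF v(1), of c d]
    by (simp add: transition_def[of "tangent_chart A c"])
qed

lemma overlap_tangent_chart:
  "fst (tangent_chart A c) \<inter> fst (tangent_chart A d) = {v \<in> TM A. fst v \<in> fst c \<inter> fst d}"
  by auto

lemma smooth_atlas_tangent_atlas: "smooth_atlas (tangent_atlas A)"
proof -
  have "open (snd (tangent_chart A c) ` fst (tangent_chart A c))" if "c \<in> A" for c
    using that by (simp add: tangent_chart_image open_Times open_chart_image del: tangent_chart_simps(2))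
  moreover have "open (snd (tangent_chart A c) ` (fst (tangent_chart A c) \<inter> fst (tangent_chart A d)))"
    "smooth_on (snd (tangent_chart A c) ` (fst (tangent_chart A c) \<inter> fst (tangent_chart A d)))
      (transition (tangent_chart A c) (tangent_chart A d))" if cd: "c \<in> A" "d \<in> A" for c d
  proof -
    let ?Z = "(snd c ` (fst c \<inter> fst d)) \<times> (UNIV :: 'e set)"
    have eq: "snd (tangent_chart A c) ` (fst (tangent_chart A c) \<inter> fst (tangent_chart A d)) = ?Z"
      using cd unfolding overlap_tangent_chart by (intro tangent_chart_image) auto
    have op: "open ?Z" using cd by (intro open_Times open_overlap open_UNIV)
    have 1: "smooth_on ?Z fst" "smooth_on ?Z snd"
      using smooth_on_bounded_linear[OF bounded_linear_fst op smooth_on_ident[OF op]]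
        smooth_on_bounded_linear[OF bounded_linear_snd op smooth_on_ident[OF op]] by simp_all
    have "smooth_on ?Z (\<lambda>z. (transition c d (fst z), frechet_derivative (transition c d) (at (fst z)) (snd z)))"
      by (intro smooth_on_Pair[OF op] smooth_on_compose[OF fd op 1(1) smooth_transition]
          smooth_on_frechet_derivative[OF fd op smooth_transition 1(1) 1(2)]) (use cd in auto)
    then have "smooth_on ?Z (transition (tangent_chart A c) (tangent_chart A d))"
      by (rule smooth_on_cong[OF op]) (use tangent_transition[OF cd] in auto)
    then show "open (snd (tangent_chart A c) ` (fst (tangent_chart A c) \<inter> fst (tangent_chart A d)))"
      "smooth_on (snd (tangent_chart A c) ` (fst (tangent_chart A c) \<inter> fst (tangent_chart A d)))
      (transition (tangent_chart A c) (tangent_chart A d))"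
      using op unfolding eq by simp_all
  qed
  ultimately show ?thesis
    unfolding smooth_atlas_def tangent_atlas_def using inj_tangent_chart by blast
qed

lemma finite_dim_atlas_tangent_atlas: "finite_dim_atlas (tangent_atlas A)"
  by (rule finite_dim_atlas.intro[OF finite_dim_prod[OF fd fd] smooth_atlas_tangent_atlas])

lemma topspace_tangent_atlas: "topspace (atlas_topology (tangent_atlas A)) = TM A"
  using finite_dim_atlas.topspace_atlas[OF finite_dim_atlas_tangent_atlas]
  by (simp add: carrier_of_tangent_atlas)

section \<open>Smooth sections in charts\<close>

lemma smooth_section_imp:
  assumes W: "openin (atlas_topology A) W" and \<sigma>: "\<And>q. q \<in> W \<Longrightarrow> fst (\<sigma> q) = q"
    and sm: "smooth_map_on W A (tangent_atlas A) \<sigma>"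
  shows "\<And>q. q \<in> W \<Longrightarrow> \<sigma> q \<in> TM A"
    and "\<And>c. c \<in> A \<Longrightarrow> smooth_on (snd c ` (W \<inter> fst c)) (\<lambda>z. snd (\<sigma> (chart_inv c z)) c)"
proof -
  have sub: "W \<subseteq> carrier_of A" using W by (simp add: openin_iff)
  show TM: "\<sigma> q \<in> TM A" if "q \<in> W" for q
    using sm that sub by (force simp: smooth_map_on_def topspace_atlas topspace_tangent_atlas
        dest: continuous_map_image_subset_topspace)
  fix c assume c: "c \<in> A"
  have dom: "W \<inter> fst c \<inter> \<sigma> -` fst (tangent_chart A c) = W \<inter> fst c" using TM \<sigma> by auto
  have op: "open (snd c ` (W \<inter> fst c))" by (rule open_image_openin[OF W c])
  have "smooth_on (snd c ` (W \<inter> fst c)) (snd (tangent_chart A c) \<circ> \<sigma> \<circ> chart_inv c)"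
    using sm c unfolding smooth_map_on_def tangent_atlas_def by (metis dom imageI)
  from smooth_on_bounded_linear[OF bounded_linear_snd op this]
  show "smooth_on (snd c ` (W \<inter> fst c)) (\<lambda>z. snd (\<sigma> (chart_inv c z)) c)" by simp
qed

text \<open>In matching charts the base component of a section is the identity, so only the fibre
  component has to be checked, one chart at a time.\<close>

lemma smooth_sectionI:
  assumes TM: "\<And>q. q \<in> carrier_of A \<Longrightarrow> \<sigma> q \<in> TM A" and \<sigma>: "\<And>q. q \<in> carrier_of A \<Longrightarrow> fst (\<sigma> q) = q"
    and sm: "\<And>c. c \<in> A \<Longrightarrow> smooth_on (snd c ` fst c) (\<lambda>z. snd (\<sigma> (chart_inv c z)) c)"
  shows "smooth_map_on (carrier_of A) A (tangent_atlas A) \<sigma>"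
  unfolding smooth_map_on_def
proof (intro conjI ballI)
  have car: "p \<in> carrier_of A" if "c \<in> A" "p \<in> fst c" for c p using that by (auto simp: carrier_of_def)
  \<comment> \<open>The coordinate expression of \<open>\<sigma>\<close> in \<open>c\<close> and
    \<open>tangent_chart A c\<close>.\<close>
  let ?g = "\<lambda>c z. (z, snd (\<sigma> (chart_inv c z)) c)"
  have g: "smooth_on (snd c ` fst c) (?g c)" if "c \<in> A" for c
    using that by (intro smooth_on_Pair smooth_on_ident sm open_chart_image)
  have "continuous_map (atlas_topology A) (atlas_topology (tangent_atlas A)) \<sigma>"
    unfolding continuous_map
  proof (intro conjI allI impI)
    show "\<sigma> ` topspace (atlas_topology A) \<subseteq> topspace (atlas_topology (tangent_atlas A))"
      using TM by (auto simp: topspace_atlas topspace_tangent_atlas)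
    fix Q assume Q: "openin (atlas_topology (tangent_atlas A)) Q"
    have "open (snd c ` ({x \<in> topspace (atlas_topology A). \<sigma> x \<in> Q} \<inter> fst c))" if c: "c \<in> A" for c
    proof -
      let ?Q = "snd (tangent_chart A c) ` (Q \<inter> fst (tangent_chart A c))"
      have "tangent_chart A c \<in> tangent_atlas A" using c by (simp add: tangent_atlas_def)
      then have "open ?Q" using Q
        unfolding openin_atlas_topology[OF smooth_atlas_tangent_atlas] by blast
      then have "open (snd c ` fst c \<inter> ?g c -` ?Q)"
        by (rule continuous_open_preimage[OF smooth_on_continuous[OF g[OF c]] open_chart_image[OF c]])
      also have "snd c ` fst c \<inter> ?g c -` ?Q = snd c ` ({x \<in> topspace (atlas_topology A). \<sigma> x \<in> Q} \<inter> fst c)"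
      proof -
        have "(snd c p, snd (\<sigma> p) c) \<in> ?Q \<longleftrightarrow> \<sigma> p \<in> Q" if p: "p \<in> fst c" for p
        proof -
          have "\<sigma> p \<in> fst (tangent_chart A c)" "snd (tangent_chart A c) (\<sigma> p) = (snd c p, snd (\<sigma> p) c)"
            using TM[of p] \<sigma>[of p] car[OF c p] p by auto
          then show ?thesis
            using inj_on_image_mem_iff[OF inj_tangent_chart[OF c], of "\<sigma> p" "Q \<inter> fst (tangent_chart A c)"]
            by (simp del: tangent_chart_simps)
        qed
        then show ?thesis using c car[OF c] by (force simp: topspace_atlas simp del: tangent_chart_simps)
      qed
      finally show ?thesis .
    qed
    then show "openin (atlas_topology A) {x \<in> topspace (atlas_topology A). \<sigma> x \<in> Q}"
      by (auto simp: openin_iff topspace_atlas)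
  qed
  then show "continuous_map (subtopology (atlas_topology A) (carrier_of A)) (atlas_topology (tangent_atlas A)) \<sigma>"
    by (rule continuous_map_from_subtopology)
  fix c d' assume c: "c \<in> A" and "d' \<in> tangent_atlas A"
  then obtain d where d: "d \<in> A" "d' = tangent_chart A d" by (auto simp: tangent_atlas_def)
  have dom: "carrier_of A \<inter> fst c \<inter> \<sigma> -` fst d' = fst c \<inter> fst d"
    using TM \<sigma> c by (auto simp: d(2) car)
  let ?Z = "snd c ` (fst c \<inter> fst d)"
  have op: "open ?Z" by (rule open_overlap[OF c d(1)])
  have sub: "transition c d ` ?Z \<subseteq> snd d ` fst d" using c by auto
  \<comment> \<open>For different charts below and above, pass to \<open>d\<close> first and use the
    expression of \<open>\<sigma>\<close> there.\<close>
  have "smooth_on ?Z (\<lambda>z. ?g d (transition c d z))"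
    by (rule smooth_on_compose[OF fd op smooth_transition[OF c d(1)] g[OF d(1)] sub])
  then have "smooth_on ?Z (snd d' \<circ> \<sigma> \<circ> chart_inv c)"
    by (rule smooth_on_cong[OF op]) (use c d \<sigma> car[OF c] in auto)
  then show "smooth_on (snd c ` (carrier_of A \<inter> fst c \<inter> \<sigma> -` fst d')) (snd d' \<circ> \<sigma> \<circ> chart_inv c)"
    by (simp add: dom)
qed

end

section \<open>Horizontal lifts\<close>

lemma sum_fun_apply: "(\<Sum>i\<in>I. f i) x = (\<Sum>i\<in>I. f i x)" for f :: "'i \<Rightarrow> 'x \<Rightarrow> 'y::comm_monoid_add"
  by (induction I rule: infinite_finite_induct) auto

lemma independent_familyD:
  fixes f :: "'i \<Rightarrow> 'v::real_vector"
  assumes "finite I" "inj_on f I" "independent (f ` I)" "(\<Sum>i\<in>I. a i *\<^sub>R f i) = 0" "i \<in> I"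
  shows "a i = 0"
proof -
  have "(\<Sum>v\<in>f ` I. a (inv_into I f v) *\<^sub>R v) = (\<Sum>i\<in>I. a i *\<^sub>R f i)"
    using assms(2) by (simp add: sum.reindex)
  then have "a (inv_into I f (f i)) = 0"
    using assms independentD[of "f ` I" "f ` I" "\<lambda>v. a (inv_into I f v)" "f i"] by simp
  then show ?thesis using assms by simp
qed

lemma span_family:
  fixes f :: "'i \<Rightarrow> 'v::real_vector"
  assumes "finite I" "inj_on f I" "x \<in> span (f ` I)"
  obtains a where "x = (\<Sum>i\<in>I. a i *\<^sub>R f i)"
proof -
  obtain u where "x = (\<Sum>v\<in>f ` I. u v *\<^sub>R v)"
    using assms(1,3) by (auto simp: span_finite)
  then have "x = (\<Sum>i\<in>I. u (f i) *\<^sub>R f i)" using assms(2) by (simp add: sum.reindex)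
  then show ?thesis by (rule that)
qed

lemma has_derivative_compose_fst:
  "(g has_derivative g') (at (fst z)) \<Longrightarrow> ((\<lambda>z. g (fst z)) has_derivative (\<lambda>e. g' (fst e))) (at z)"
  by (rule has_derivative_compose[OF has_derivative_fst[OF has_derivative_ident]])

section \<open>The projection \<open>pi_star A\<close> in charts\<close>

context finite_dim_atlas
begin

interpretation T: finite_dim_atlas "tangent_atlas A"
  by (rule finite_dim_atlas_tangent_atlas)

lemma tangent_chart_mem: "c \<in> A \<Longrightarrow> tangent_chart A c \<in> tangent_atlas A"
  by (simp add: tangent_atlas_def)

lemma TTM_base: "w \<in> TTM A \<Longrightarrow> fst w \<in> TM A"
  using T.tangent_bundleD(1) by (simp add: carrier_of_tangent_atlas)

lemma base_coordinates:
  assumes "c \<in> A" "x \<in> snd c ` fst c"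
  shows "fst (chart_inv (tangent_chart A c) (x, e)) = chart_inv c x"
proof -
  obtain v where "v \<in> TM A" "fst v \<in> fst c" "(x, e) = (snd c (fst v), snd v c)"
    using tangent_chart_point[OF assms(1) subset_refl, of "(x, e)"] assms(2) by auto
  then show ?thesis using assms chart_inv_tangent_chart[of c v] by simp
qed

lemma derivative_base_coordinates:
  assumes "c \<in> A" "d \<in> A" "p \<in> fst c" "p \<in> fst d"
  shows "frechet_derivative (snd d \<circ> fst \<circ> chart_inv (tangent_chart A c)) (at (snd c p, e)) w =
    frechet_derivative (transition c d) (at (snd c p)) (fst w)"
proof -
  have "((\<lambda>z. transition c d (fst z)) has_derivative
      (\<lambda>w. frechet_derivative (transition c d) (at (snd c p)) (fst w))) (at (snd c p, e))"
    by (rule has_derivative_compose_fst) (simp add: has_derivative_transition[OF assms])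
  then have "((snd d \<circ> fst \<circ> chart_inv (tangent_chart A c)) has_derivative
      (\<lambda>w. frechet_derivative (transition c d) (at (snd c p)) (fst w))) (at (snd c p, e))"
    by (rule has_derivative_transform_within_open[OF _ open_Times[OF open_chart_image[OF assms(1)] open_UNIV]])
      (use assms in \<open>auto simp: base_coordinates\<close>)
  from frechet_derivative_at[OF this] show ?thesis by metis
qed

text \<open>The base part of a transition between tangent charts does not involve the fibre
  coordinate, so its derivative sees only the first component X of (X, Y).\<close>

lemma TTM_fst_coordinates:
  assumes w: "w \<in> TTM A" and cd: "c \<in> A" "d \<in> A" "fst (fst w) \<in> fst c" "fst (fst w) \<in> fst d"
  shows "fst (snd w (tangent_chart A d)) =
    frechet_derivative (transition c d) (at (snd c (fst (fst w)))) (fst (snd w (tangent_chart A c)))"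
proof -
  let ?C = "tangent_chart A c" and ?D = "tangent_chart A d" and ?p = "fst (fst w)"
  let ?z = "(snd c ?p, snd (fst w) c)"
  let ?\<tau> = "frechet_derivative (transition ?C ?D) (at ?z)"
  have "(transition ?C ?D has_derivative ?\<tau>) (at ?z)"
    using T.has_derivative_transition[of ?C ?D "fst w"] cd TTM_base[OF w] by (simp add: tangent_chart_mem)
  then have "((\<lambda>z. fst (transition ?C ?D z)) has_derivative (\<lambda>e. fst (?\<tau> e))) (at ?z)"
    by (rule has_derivative_fst)
  then have "((\<lambda>z. transition c d (fst z)) has_derivative (\<lambda>e. fst (?\<tau> e))) (at ?z)"
    by (rule has_derivative_transform_within_open[OF _ open_Times[OF open_overlap[OF cd(1,2)] open_UNIV]])
      (use cd in \<open>auto simp: tangent_transition\<close>)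
  moreover have "((\<lambda>z. transition c d (fst z)) has_derivative
      (\<lambda>e. frechet_derivative (transition c d) (at (snd c ?p)) (fst e))) (at ?z)"
    by (rule has_derivative_compose_fst) (simp add: has_derivative_transition[OF cd])
  ultimately have "fst (?\<tau> e) = frechet_derivative (transition c d) (at (snd c ?p)) (fst e)" for e
    using has_derivative_unique by metis
  moreover have "snd w ?D = ?\<tau> (snd w ?C)"
    using T.tangent_bundleD(2)[OF w tangent_chart_mem tangent_chart_mem, of c d] cd TTM_base[OF w] by simp
  ultimately show ?thesis by simp
qed

text \<open>\<open>tangent_map\<close> works in the chart picked by \<open>chart_at\<close>;
  \<open>TTM_fst_coordinates\<close> removes the dependence on that choice.\<close>

lemma pi_star_eq:
  assumes w: "w \<in> TTM A"
  shows "pi_star A w = (fst (fst w), \<lambda>d. if d \<in> A \<and> fst (fst w) \<in> fst d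
    then fst (snd w (tangent_chart A d)) else 0)"
proof -
  let ?v = "fst w"
  have v: "?v \<in> TM A" by (rule TTM_base[OF w])
  then have "\<exists>C. C \<in> tangent_atlas A \<and> ?v \<in> fst C"
    unfolding carrier_of_tangent_atlas[symmetric] carrier_of_def by blast
  then have "chart_at (tangent_atlas A) ?v \<in> tangent_atlas A \<and> ?v \<in> fst (chart_at (tangent_atlas A) ?v)"
    unfolding chart_at_def by (rule someI_ex)
  then obtain c where c: "c \<in> A" "chart_at (tangent_atlas A) ?v = tangent_chart A c" "fst ?v \<in> fst c"
    by (auto simp: tangent_atlas_def)
  have "frechet_derivative (snd d \<circ> fst \<circ> chart_inv (tangent_chart A c)) (at (snd (tangent_chart A c) ?v))
      (snd w (tangent_chart A c)) = fst (snd w (tangent_chart A d))" if "d \<in> A" "fst ?v \<in> fst d" for d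
    using derivative_base_coordinates[OF c(1) that(1) c(3) that(2)] TTM_fst_coordinates[OF w c(1) that(1) c(3) that(2)]
    by simp
  then show ?thesis
    by (auto simp: tangent_map_def Let_def c(2) fun_eq_iff simp del: tangent_chart_simps)
qed

lemma fst_pi_star: "w \<in> TTM A \<Longrightarrow> fst (pi_star A w) = fst (fst w)"
  by (simp add: pi_star_eq)

lemma snd_pi_star:
  "w \<in> TTM A \<Longrightarrow> c \<in> A \<Longrightarrow> fst (fst w) \<in> fst c \<Longrightarrow> snd (pi_star A w) c = fst (snd w (tangent_chart A c))"
  by (simp add: pi_star_eq)

lemma pi_star_TM:
  assumes w: "w \<in> TTM A"
  shows "pi_star A w \<in> TM A"
proof (rule tangent_bundleI)
  show "fst (pi_star A w) \<in> carrier_of A"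
    using tangent_bundleD(1)[OF TTM_base[OF w]] by (simp add: fst_pi_star[OF w])
  fix c d assume "c \<in> A" "d \<in> A" "fst (pi_star A w) \<in> fst c" "fst (pi_star A w) \<in> fst d"
  then show "snd (pi_star A w) d =
      frechet_derivative (transition c d) (at (snd c (fst (pi_star A w)))) (snd (pi_star A w) c)"
    using TTM_fst_coordinates[OF w, of c d] by (simp add: fst_pi_star[OF w] snd_pi_star[OF w])
qed (use w in \<open>auto simp: pi_star_eq\<close>)

section \<open>Horizontal spaces of a connection\<close>

context
  fixes H :: "(('a, 'e) tvec, 'e \<times> 'e) tvec set"
  assumes conn: "connection A H"
begin

lemma horizontal_TTM: "h \<in> fibre H v \<Longrightarrow> (v, h) \<in> TTM A"
  using conn by (auto simp: connection_def smooth_subbundle_def fibre_def)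

lemma horizontal_frame:
  assumes "v \<in> TM A"
  obtains W k and \<sigma> :: "nat \<Rightarrow> ('a, 'e) tvec \<Rightarrow> (('a, 'e) tvec, 'e \<times> 'e) tvec"
  where "openin (atlas_topology (tangent_atlas A)) W" "v \<in> W"
    "\<forall>i<k. smooth_map_on W (tangent_atlas A) (tangent_atlas (tangent_atlas A)) (\<sigma> i) \<and>
       (\<forall>q\<in>W. fst (\<sigma> i q) = q)"
    "\<forall>q\<in>W. inj_on (\<lambda>i. snd (\<sigma> i q)) {..<k} \<and>
       independent ((\<lambda>i. snd (\<sigma> i q)) ` {..<k}) \<and> span ((\<lambda>i. snd (\<sigma> i q)) ` {..<k}) = fibre H q"
proof -
  have "smooth_subbundle (tangent_atlas A) H" using conn by (simp add: connection_def)
  then show ?thesis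
    using assms unfolding smooth_subbundle_def carrier_of_tangent_atlas
    by - (elim conjE, drule (1) bspec, elim exE conjE, rule that, assumption+)
qed

text \<open>The linear structure comes from the local frame, which exhibits the fibre as a
  span.\<close>

lemma subspace_horizontal:
  assumes "v \<in> TM A"
  shows "subspace (fibre H v)"
proof (rule horizontal_frame[OF assms])
  fix W k \<sigma>
  assume "v \<in> W" "\<forall>q\<in>W. inj_on (\<lambda>i. snd (\<sigma> i q)) {..<k::nat} \<and>
    independent ((\<lambda>i. snd (\<sigma> i q)) ` {..<k}) \<and> span ((\<lambda>i. snd (\<sigma> i q)) ` {..<k}) = fibre H q"
  then have "fibre H v = span ((\<lambda>i. snd (\<sigma> i v)) ` {..<k})" by simp
  then show ?thesis by simp
qed

text \<open>A vanishing first component in one chart makes \<open>h\<close> vertical. This yields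
  both injectivity of \<open>pi_star A\<close> and independence of the first components of a
  frame.\<close>

lemma horizontal_eq_0:
  assumes v: "v \<in> TM A" and h: "h \<in> fibre H v" and c: "c \<in> A" "fst v \<in> fst c"
    and 0: "fst (h (tangent_chart A c)) = 0"
  shows "h = 0"
proof -
  have w: "(v, h) \<in> TTM A" by (rule horizontal_TTM[OF h])
  have "(fst v, 0) \<in> TM A"
    using subspace_0[OF subspace_tangent_fibre[OF tangent_bundleD(1)[OF v]]] by (simp add: fibre_def)
  then have "pi_star A (v, h) = (fst v, 0)"
    by (rule tangent_vector_eqI[OF pi_star_TM[OF w] _ _ _ c(1)])
      (use c 0 in \<open>simp_all add: fst_pi_star[OF w] snd_pi_star[OF w]\<close>)
  then have "h \<in> fibre (vertical_bundle A) v" using w by (simp add: fibre_def vertical_bundle_def)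
  then show ?thesis using h v conn by (auto simp: connection_def)
qed

text \<open>\<open>pi_star A\<close> acts on pairs, so the singleton factors carry the base
  points.\<close>

lemma bij_pi_star_horizontal:
  assumes v: "v \<in> TM A"
  shows "bij_betw (pi_star A) ({v} \<times> fibre H v) ({fst v} \<times> fibre (TM A) (fst v))"
proof (rule bij_betwI')
  obtain c where c: "c \<in> A" "fst v \<in> fst c"
    using tangent_bundleD(1)[OF v] by (auto simp: carrier_of_def)
  show "pi_star A x = pi_star A y \<longleftrightarrow> x = y"
    if x: "x \<in> {v} \<times> fibre H v" and y: "y \<in> {v} \<times> fibre H v" for x y
  proof
    assume eq: "pi_star A x = pi_star A y"
    obtain h h' where hh: "x = (v, h)" "y = (v, h')" "h \<in> fibre H v" "h' \<in> fibre H v"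
      using x y by auto
    have "fst (h (tangent_chart A c)) = fst (h' (tangent_chart A c))"
      using snd_pi_star[OF horizontal_TTM[OF hh(3)] c(1)] snd_pi_star[OF horizontal_TTM[OF hh(4)] c(1)] c eq hh
      by simp
    then have "h - h' = 0"
      by (intro horizontal_eq_0[OF v _ c] subspace_diff[OF subspace_horizontal[OF v]] hh) simp
    then show "x = y" using hh by simp
  qed simp
  show "pi_star A x \<in> {fst v} \<times> fibre (TM A) (fst v)" if x: "x \<in> {v} \<times> fibre H v" for x
  proof -
    have "x \<in> TTM A" "fst x = v" using x horizontal_TTM by auto
    then show ?thesis using pi_star_TM[of x] fst_pi_star[of x] by (cases "pi_star A x") (auto simp: fibre_def)
  qed
  show "\<exists>x\<in>{v} \<times> fibre H v. u = pi_star A x" if u: "u \<in> {fst v} \<times> fibre (TM A) (fst v)" for u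
  proof -
    have u': "u \<in> TM A" "fst u = fst v" using u by (auto simp: fibre_def)
    let ?C = "tangent_chart A c"
    \<comment> \<open>Some lift of \<open>u\<close>, with second component 0 in this chart. Removing
      its vertical part makes it horizontal and keeps the first component.\<close>
    obtain \<xi> where \<xi>: "(v, \<xi>) \<in> TTM A" "\<xi> ?C = (snd u c, 0)"
      using T.tangent_vector_exists[OF tangent_chart_mem[OF c(1)], of v] c v by auto
    then have "\<xi> \<in> fibre (TTM A) v" by (simp add: fibre_def)
    then obtain h k where hk: "\<xi> = h + k" "h \<in> fibre H v" "k \<in> fibre (vertical_bundle A) v"
      using conn v unfolding connection_def by blast
    have h: "(v, h) \<in> TTM A" by (rule horizontal_TTM[OF hk(2)])
    have k: "(v, k) \<in> TTM A" "snd (pi_star A (v, k)) = 0"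
      using hk(3) by (auto simp: fibre_def vertical_bundle_def)
    then have "fst (k ?C) = 0" using snd_pi_star[OF k(1) c(1)] c(2) by simp
    then have "fst (h ?C) = snd u c" using \<xi>(2) hk(1) by (simp add: prod_eq_iff)
    then have "pi_star A (v, h) = u"
      by (intro tangent_vector_eqI[OF pi_star_TM[OF h] u'(1) _ _ c(1)])
        (use c u' in \<open>simp_all add: fst_pi_star[OF h] snd_pi_star[OF h]\<close>)
    then show ?thesis using hk(2) by auto
  qed
qed

lemma smooth_horizontal_lift:
  assumes SH: "\<And>v. v \<in> TM A \<Longrightarrow> S v \<in> {v} \<times> fibre H v" and pi: "\<And>v. v \<in> TM A \<Longrightarrow> pi_star A (S v) = v"
  shows "smooth_map_on (TM A) (tangent_atlas A) (tangent_atlas (tangent_atlas A)) S"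
  unfolding carrier_of_tangent_atlas[symmetric]
proof (rule T.smooth_sectionI, unfold carrier_of_tangent_atlas)
  show "S q \<in> TTM A" "fst (S q) = q" if "q \<in> TM A" for q
    using SH[OF that] horizontal_TTM by auto
  fix C assume "C \<in> tangent_atlas A"
  then obtain c where c: "c \<in> A" and C_def: "C = tangent_chart A c" by (auto simp: tangent_atlas_def)
  have C: "C \<in> tangent_atlas A" by fact
  have fstC: "v \<in> fst C \<longleftrightarrow> v \<in> TM A \<and> fst v \<in> fst c" for v by (auto simp: C_def)
  show "smooth_on (snd C ` fst C) (\<lambda>z. snd (S (chart_inv C z)) C)"
  proof (rule smooth_on_locally)
    fix z0 assume "z0 \<in> snd C ` fst C"
    then obtain v0 where v0: "v0 \<in> fst C" "z0 = snd C v0" by auto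
    obtain W k and \<sigma> :: "nat \<Rightarrow> ('a, 'e) tvec \<Rightarrow> (('a, 'e) tvec, 'e \<times> 'e) tvec"
      where W: "openin (atlas_topology (tangent_atlas A)) W" "v0 \<in> W"
        and \<sigma>: "\<forall>i<k. smooth_map_on W (tangent_atlas A) (tangent_atlas (tangent_atlas A)) (\<sigma> i) \<and>
          (\<forall>q\<in>W. fst (\<sigma> i q) = q)"
        and frame: "\<forall>q\<in>W. inj_on (\<lambda>i. snd (\<sigma> i q)) {..<k} \<and>
          independent ((\<lambda>i. snd (\<sigma> i q)) ` {..<k}) \<and> span ((\<lambda>i. snd (\<sigma> i q)) ` {..<k}) = fibre H q"
      using horizontal_frame[of v0] v0(1) unfolding fstC by blast
    define U where "U = snd C ` (W \<inter> fst C)"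
    have U: "open U" "z0 \<in> U"
      using T.open_image_openin[OF W(1) C] W(2) v0 by (auto simp: U_def)
    define F where "F i z = snd (\<sigma> i (chart_inv C z)) C" for i z
    have F: "smooth_on U (F i)" if "i < k" for i
      unfolding F_def U_def by (rule T.smooth_section_imp(2)[OF W(1) _ _ C]) (use \<sigma> that in auto)
    have X: "smooth_on U (\<lambda>z. fst (F i z))" if "i < k" for i
      by (rule smooth_on_bounded_linear[OF bounded_linear_fst U(1) F[OF that]])
    have combination: "(\<Sum>i<k. a i *\<^sub>R snd (\<sigma> i v)) C = (\<Sum>i<k. a i *\<^sub>R F i (snd C v))"
      if "v \<in> fst C" for a v
      using T.chart_inv_chart[OF C that] by (simp add: F_def sum_fun_apply scaleR_fun_def)
    \<comment> \<open>Only the first components are assumed to cancel, but the whole combination is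
      horizontal, so it vanishes and the independence of the frame applies.\<close>
    have indep: "\<forall>i<k. a i = 0" if a: "(\<Sum>i<k. a i *\<^sub>R fst (F i z0)) = 0" for a
    proof -
      let ?h = "\<Sum>i<k. a i *\<^sub>R snd (\<sigma> i v0)"
      have "?h \<in> span ((\<lambda>i. snd (\<sigma> i v0)) ` {..<k})"
        by (intro span_sum span_scale span_base imageI)
      then have "?h \<in> fibre H v0" using frame W(2) by blast
      moreover have "fst (?h C) = 0" using a v0 by (simp add: combination fst_sum)
      ultimately have "?h = 0"
        using horizontal_eq_0[of v0 ?h c, folded C_def] c fstC[of v0] v0(1) by blast
      moreover have "inj_on (\<lambda>i. snd (\<sigma> i v0)) {..<k}" "independent ((\<lambda>i. snd (\<sigma> i v0)) ` {..<k})"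
        using frame W(2) by blast+
      ultimately show ?thesis
        using independent_familyD[of "{..<k}" "\<lambda>i. snd (\<sigma> i v0)" a] by simp
    qed
    obtain V and L :: "nat \<Rightarrow> 'e \<times> 'e \<Rightarrow> 'e \<Rightarrow> real"
      where V: "open V" "z0 \<in> V" "V \<subseteq> U"
        and L: "\<forall>i<k. (\<forall>z\<in>V. linear (L i z) \<and>
            (\<forall>j<k. L i z (fst (F j z)) = (if i = j then 1 else 0))) \<and>
          (\<forall>W g. open W \<and> W \<subseteq> V \<and> smooth_on W g \<longrightarrow> smooth_on W (\<lambda>z. L i z (g z)))"
      by (rule exE[OF smooth_dual_frame[where X = "\<lambda>i z. fst (F i z)" and k = k, OF fd U]],
          erule X, erule indep, elim exE conjE, rule that, assumption+)
    \<comment> \<open>\<open>snd z\<close> is the fibre coordinate y of the point \<open>z\<close> =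
      (x, y); the sum is the candidate expression of \<open>S\<close>, compared with
      \<open>S\<close> pointwise below.\<close>
    have "smooth_on V (\<lambda>z. \<Sum>i<k. L i z (snd z) *\<^sub>R F i z)"
    proof (intro smooth_on_sum smooth_on_scaleR V(1))
      fix i assume i: "i \<in> {..<k}"
      then show "smooth_on V (F i)" by (intro smooth_on_subset[OF F V(3)]) simp
      show "smooth_on V (\<lambda>z. L i z (snd z))"
        using L i V(1) smooth_on_bounded_linear[OF bounded_linear_snd V(1) smooth_on_ident[OF V(1)]] by blast
    qed
    then have "smooth_on V (\<lambda>z. snd (S (chart_inv C z)) C)"
    proof (rule smooth_on_cong[OF V(1)])
      fix z assume z: "z \<in> V"
      then obtain v where v: "v \<in> W" "v \<in> fst C" "z = snd C v" using V(3) by (auto simp: U_def)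
      have vTM: "v \<in> TM A" "fst v \<in> fst c" using v(2) unfolding fstC by auto
      obtain s where s: "S v = (v, s)" "s \<in> fibre H v" using SH[OF vTM(1)] by auto
      then have "s \<in> span ((\<lambda>i. snd (\<sigma> i v)) ` {..<k})" using frame v(1) by blast
      then obtain a where a: "s = (\<Sum>i<k. a i *\<^sub>R snd (\<sigma> i v))"
        using span_family[of "{..<k}" "\<lambda>i. snd (\<sigma> i v)" s] frame v(1) by blast
      have sC: "s C = (\<Sum>i<k. a i *\<^sub>R F i z)" using combination[OF v(2)] a v(3) by simp
      \<comment> \<open>In coordinates \<open>pi_star A (S v) = v\<close> says that the first
        component of \<open>S v\<close> is y. Hence the frame coefficients \<open>a\<close>, chosen
        pointwise, are recovered from y by the functionals \<open>L i z\<close>.\<close>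
      have "snd v c = fst (s C)"
        using snd_pi_star[OF horizontal_TTM[OF s(2)] c] vTM pi[OF vTM(1)] s(1) by (simp add: C_def)
      then have y: "snd z = (\<Sum>j<k. a j *\<^sub>R fst (F j z))"
        using v(3) by (simp add: sC fst_sum) (simp add: C_def)
      have "L i z (snd z) = a i" if "i < k" for i
      proof -
        have "L i z (snd z) = (\<Sum>j<k. a j *\<^sub>R L i z (fst (F j z)))"
          using L that z unfolding y by (simp add: linear_sum linear_cmul)
        also have "\<dots> = (\<Sum>j<k. if i = j then a i else 0)"
          by (rule sum.cong) (use L that z in auto)
        finally show ?thesis using that by simp
      qed
      then show "(\<Sum>i<k. L i z (snd z) *\<^sub>R F i z) = snd (S (chart_inv C z)) C"
        using sC s(1) v(3) T.chart_inv_chart[OF C v(2)] by simp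
    qed
    then show "\<exists>V. open V \<and> z0 \<in> V \<and> smooth_on V (\<lambda>z. snd (S (chart_inv C z)) C)"
      using V by blast
  qed
qed

end

end

theorem theorem4p2:
  fixes A :: "('a, 'e::real_normed_vector) chart set"
    and H :: "(('a, 'e) tvec, 'e \<times> 'e) tvec set"
    and S :: "('a, 'e) tvec \<Rightarrow> (('a, 'e) tvec, 'e \<times> 'e) tvec"
  assumes "smooth_manifold A"
    and "connection A H"
    and "\<And>v. v \<in> TM A \<Longrightarrow> S v = inv_into ({v} \<times> fibre H v) (pi_star A) v"
  shows "(\<forall>v\<in>TM A. bij_betw (pi_star A) ({v} \<times> fibre H v) ({fst v} \<times> fibre (TM A) (fst v)))
         \<and> SODE A S"
proof -
  interpret finite_dim_atlas A
    using assms(1) by (simp add: smooth_manifold_def finite_dim_def finite_dim_atlas_def)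
  have bij: "bij_betw (pi_star A) ({v} \<times> fibre H v) ({fst v} \<times> fibre (TM A) (fst v))" if "v \<in> TM A" for v
    by (rule bij_pi_star_horizontal[OF assms(2) that])
  \<comment> \<open>\<open>inv_into\<close> is a genuine preimage only on the image; here
    \<open>v\<close> is itself an element of the target fibre over \<open>fst v\<close>.\<close>
  have mem: "v \<in> pi_star A ` ({v} \<times> fibre H v)" if "v \<in> TM A" for v
    using bij_betw_imp_surj_on[OF bij[OF that]] that by (cases v) (simp add: fibre_def)
  have S: "S v \<in> {v} \<times> fibre H v" "pi_star A (S v) = v" if "v \<in> TM A" for v
    using inv_into_into[OF mem[OF that]] f_inv_into_f[OF mem[OF that]] assms(3)[OF that] by simp_all
  have "fst (S v) = v" if "v \<in> TM A" for v using S(1)[OF that] by auto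
  then have "SODE A S"
    using smooth_horizontal_lift[OF assms(2), of S] S by (simp add: SODE_def)
  then show ?thesis using bij by blast
qed

end
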